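(* Let $(S_n)_{n\in\mathbb{Z}}$ and $(T_n)_{n\in\mathbb{Z}}$ be the integer sequences described in the context. For each integer $n\geq 1$ put \[ a = |S_{n+1}S_{n+2}^3S_{n+3}T_{n+2}+S_n^2S_{n+1}T_{n+3}T_{n+4}^2|,\quad b = | S_n^2S_{n+1}T_{n+3}T_{n+4}^2-T_{n+1}T_{n+2}^3T_{n+3}S_{n+2}|, \] \[ c = |T_{n+1}T_{n+2}^3T_{n+3}S_{n+2}-S_{n+1}S_{n+2}^3S_{n+3}T_{n+2}|, \] \[ k = \tfrac{1}{2}\,|S_{n+4}T_{n+4}(T_{n}T_{n+1}^2T_{n+2}-S_{n}S_{n+1}^2S_{n+2})|,\qquad \ell = \tfrac{1}{2}\,|S_nT_n(T_{n+2}T_{n+3}^2T_{n+4}-S_{n+2}S_{n+3}^2S_{n+4})|, \] \[ \Delta = |S_nS_{n+1}S_{n+2}^2S_{n+3}S_{n+4}T_nT_{n+1}T_{n+2}^2T_{n+3}T_{n+4}|. \] Then $a,b,c$ are positive integers with $\gcd(a,b,c)=1$ which are the side lengths of a (non-degenerate) triangle; the median of this triangle bisecting the side of length $a$ has length $k$ and the median bisecting the side of length $b$ has length $\ell$ (so $k^2=\frac14(2b^2+2c^2-a^2)$ and $\ell^2=\frac14(2c^2+2a^2-b^2)$, both rational); and the area of the triangle is $\Delta$ (i.e. $\Delta^2=s(s-a)(s-b)(s-c)$ with $s=\frac{a+b+c}{2}$). In particular each such triangle is a Heron triangle with two rational medians.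
   Context: $(S_n)_{n\in\mathbb{Z}}$ is the sequence with $S_{-2}=S_{-1}=S_0=S_1=S_2=1$ satisfying $S_{n+5}S_n=S_{n+4}S_{n+1}+S_{n+3}S_{n+2}$ for all $n\in\mathbb{Z}$ (iterated forwards and backwards); it consists of positive integers, satisfies $S_{-n}=S_n$, and $S_0,\dots,S_9=1,1,1,2,3,5,11,37,83,274$. $(T_n)_{n\in\mathbb{Z}}$ is defined by $T_1=1,T_2=-1,T_3=1,T_4=1,T_5=-7$, $T_{n+5}T_n=T_{n+4}T_{n+1}+T_{n+3}T_{n+2}$ for $n\geq1$, $T_0=0$ and $T_{-n}=-T_n$; it is an integer sequence with $T_n\neq 0$ for $n\neq0$, satisfying the same recurrence for all $n\in\mathbb{Z}$, and $T_0,\dots,T_9=0,1,-1,1,1,-7,8,-1,-57,391$. *)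

theory Defs
  imports "HOL-Analysis.Analysis"
begin

text \<open>
  Both sequences are obtained by solving the recurrence
  \<open>X (n + 5) * X n = X (n + 4) * X (n + 1) + X (n + 3) * X (n + 2)\<close> for its outermost term over the
  reals, so integrality is not built into the definitions.  The divisor never vanishes:
  \<open>somos_S\<close> is positive, and \<open>somos_T n\<close> is zero only for \<open>n = 0\<close>.
\<close>

function somos_S :: "int \<Rightarrow> real" where
  "somos_S n =
    (if - 2 \<le> n \<and> n \<le> 2 then 1
     else if 2 < n then
       (somos_S (n - 1) * somos_S (n - 4) + somos_S (n - 2) * somos_S (n - 3)) / somos_S (n - 5)
     else
       (somos_S (n + 4) * somos_S (n + 1) + somos_S (n + 3) * somos_S (n + 2)) / somos_S (n + 5))"
  by pat_completeness auto
termination by (relation "Wellfounded.measure (\<lambda>n. nat \<bar>n\<bar>)") auto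

declare somos_S.simps [simp del]

function somos_T :: "int \<Rightarrow> real" where
  "somos_T n =
    (if n < 0 then - somos_T (- n)
     else if n = 0 then 0
     else if n = 1 then 1
     else if n = 2 then - 1
     else if n = 3 then 1
     else if n = 4 then 1
     else if n = 5 then - 7
     else
       (somos_T (n - 1) * somos_T (n - 4) + somos_T (n - 2) * somos_T (n - 3)) / somos_T (n - 5))"
  by pat_completeness auto
termination by (relation "Wellfounded.measure (\<lambda>n. if n < 0 then nat (- n) + 1 else nat n)") auto

declare somos_T.simps [simp del]

lemma somos_S_pos: "0 < somos_S n"
proof (induction n rule: somos_S.induct)
  case (1 n)
  show ?case
    using 1 by (subst somos_S.simps) (auto intro!: divide_pos_pos add_pos_pos mult_pos_pos)
qed

lemma somos_S_recurrence:
  "somos_S (n + 5) * somos_S n = somos_S (n + 4) * somos_S (n + 1) + somos_S (n + 3) * somos_S (n + 2)"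
proof (cases "- 2 \<le> n")
  case True
  then show ?thesis
    using somos_S_pos[of n] by (subst somos_S.simps[of "n + 5"]) (auto simp: field_simps)
next
  case False
  then show ?thesis
    using somos_S_pos[of "n + 5"] by (subst somos_S.simps[of n]) (auto simp: field_simps)
qed

lemma somos_T_minus: "somos_T (- n) = - somos_T n"
  by (cases n "0 :: int" rule: linorder_cases)
     (simp_all add: somos_T.simps[of n] somos_T.simps[of "- n"] somos_T.simps[of 0])

lemma somos_T_recurrence:
  assumes "1 \<le> n" "somos_T n \<noteq> 0"
  shows "somos_T (n + 5) * somos_T n = somos_T (n + 4) * somos_T (n + 1) + somos_T (n + 3) * somos_T (n + 2)"
  using assms by (subst somos_T.simps[of "n + 5"]) (auto simp: field_simps)

lemma somos_S_values:
  "map somos_S [0..9] = [1, 1, 1, 2, 3, 5, 11, 37, 83, 274]"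
  by (simp add: upto.simps somos_S.simps)

lemma somos_T_values:
  "map somos_T [0..9] = [0, 1, - 1, 1, 1, - 7, 8, - 1, - 57, 391]"
  by (simp add: upto.simps somos_T.simps)

definition triangle_with_sides :: "real^2 \<Rightarrow> real^2 \<Rightarrow> real^2 \<Rightarrow> real \<Rightarrow> real \<Rightarrow> real \<Rightarrow> bool" where
  "triangle_with_sides A B C a b c \<longleftrightarrow>
    \<not> collinear {A, B, C} \<and> dist B C = a \<and> dist C A = b \<and> dist A B = c"

definition triangle_area :: "real^2 \<Rightarrow> real^2 \<Rightarrow> real^2 \<Rightarrow> real" where
  "triangle_area A B C = measure lebesgue (convex hull {A, B, C})"

definition heron_triangle :: "real^2 \<Rightarrow> real^2 \<Rightarrow> real^2 \<Rightarrow> bool" where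
  "heron_triangle A B C \<longleftrightarrow>
    \<not> collinear {A, B, C} \<and> dist B C \<in> \<int> \<and> dist C A \<in> \<int> \<and> dist A B \<in> \<int> \<and> triangle_area A B C \<in> \<int>"

end

theory Submission
  imports Defs
begin

text \<open>
  Both sequences live on one elliptic curve: \<open>T\<close> is an elliptic sequence for multiples of a point and
  \<open>S\<close> is its translate by a point of order two. Concretely, consecutive quotients \<open>u = T n / S n\<close>
  (\<open>n\<close> even) and \<open>v = T (n \<plusminus> 1) / S (n \<plusminus> 1)\<close> satisfy the biquadratic
  \<open>(1 + u\<^sup>2) v\<^sup>2 + 3 u v + 2 u\<^sup>2 - 1 = 0\<close>. By Vieta, \<open>S (n + 1) S (n - 1)\<close>, \<open>T (n + 1) T (n - 1)\<close>
  and \<open>T (n + 1) S (n - 1) + T (n - 1) S (n + 1)\<close> are quadratic forms in \<open>S n, T n\<close> whose coefficients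
  depend on the parity of \<open>n\<close>; the Somos-5 recurrence, coprimality of nearby terms, integrality and
  the identities for the triangle all follow from these three families.

  With \<open>x, y, z\<close> the three products occurring in the sides and
  \<open>w = S (n + 3) S (n + 4)\<^sup>2 T n\<^sup>2 T (n + 1)\<close>, the key identity is \<open>z = x + y + w\<close>: it turns
  Heron's formula into \<open>\<Delta>\<^sup>2 = x y z w\<close>.
\<close>

section \<open>Quotients of the two sequences\<close>

text \<open>
  The sum of the roots of the biquadratic gives a recursion for \<open>T n / S n\<close> that never divides by zero,
  so non-vanishing of \<open>T\<close> can be settled before the Somos recurrence is divided by a term of \<open>T\<close>.
\<close>

fun ratio :: "nat \<Rightarrow> real" where
  "ratio 0 = 0"
| "ratio (Suc 0) = 1"
| "ratio (Suc (Suc n)) =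
     - ratio n - 3 * ratio (Suc n) / ((if odd n then 1 else 2) + (ratio (Suc n))\<^sup>2)"

text \<open>Built from the product of the two neighbours of index \<open>Suc n\<close>, whose form
  depends on the parity of that index: S^2 + T^2 if it is even, (2 S^2 + T^2) / 3 if it is odd.
  Positivity is then immediate, while Somos-5 becomes a theorem.\<close>

fun sseq :: "nat \<Rightarrow> real" where
  "sseq 0 = 1"
| "sseq (Suc 0) = 1"
| "sseq (Suc (Suc n)) =
     (sseq (Suc n))\<^sup>2 * (if odd n then 1 + (ratio (Suc n))\<^sup>2 else (2 + (ratio (Suc n))\<^sup>2) / 3) / sseq n"

definition tseq :: "nat \<Rightarrow> real" where
  "tseq n = ratio n * sseq n"

text \<open>Not symmetric: the first argument is meant for the quotient of even index, the second
  for that of odd index.\<close>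

definition ratio_curve :: "real \<Rightarrow> real \<Rightarrow> bool" where
  "ratio_curve u v \<longleftrightarrow> (1 + u\<^sup>2) * v\<^sup>2 + 3 * u * v + 2 * u\<^sup>2 - 1 = 0"

lemma sseq_pos: "0 < sseq n"
  by (induction n rule: sseq.induct) (auto intro!: divide_pos_pos mult_pos_pos add_pos_nonneg)

lemma sseq_nonzero [simp]: "sseq n \<noteq> 0"
  using sseq_pos[of n] by simp

lemma one_plus_square_nonzero [simp]: "1 + (x::real)\<^sup>2 \<noteq> 0" "2 + (x::real)\<^sup>2 \<noteq> 0"
  using zero_le_power2[of x] by linarith+

text \<open>By Vieta: with the quotient at \<open>Suc n\<close> held fixed, the recursion prescribes
  the sum of the roots of the remaining quadratic, so it passes from one root to the other and stays
  on the curve.\<close>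

lemma ratio_curve_even_odd:
  "ratio_curve (if even n then ratio n else ratio (Suc n)) (if even n then ratio (Suc n) else ratio n)"
proof (induction n)
  case 0
  then show ?case by (simp add: ratio_curve_def)
next
  case (Suc n)
  show ?case
  proof (cases "even n")
    case True
    define u v where "u = ratio n" and "v = ratio (Suc n)"
    have uv: "(1 + u\<^sup>2) * v\<^sup>2 + 3 * u * v + 2 * u\<^sup>2 - 1 = 0"
      using Suc True by (simp add: ratio_curve_def u_def v_def)
    have r: "ratio (Suc (Suc n)) = - u - 3 * v / (2 + v\<^sup>2)"
      using True by (simp add: u_def v_def)
    define w where "w = - u - 3 * v / (2 + v\<^sup>2)"
    have "(2 + v\<^sup>2) * (u + w) = - 3 * v"
      by (simp add: w_def field_simps)
    then have "(1 + w\<^sup>2) * v\<^sup>2 + 3 * w * v + 2 * w\<^sup>2 - 1 = 0"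
      using uv by algebra
    then show ?thesis
      using True r unfolding ratio_curve_def by (simp add: v_def w_def del: ratio.simps)
  next
    case False
    define u v where "u = ratio (Suc n)" and "v = ratio n"
    have uv: "(1 + u\<^sup>2) * v\<^sup>2 + 3 * u * v + 2 * u\<^sup>2 - 1 = 0"
      using Suc False by (simp add: ratio_curve_def u_def v_def)
    have r: "ratio (Suc (Suc n)) = - v - 3 * u / (1 + u\<^sup>2)"
      using False by (simp add: u_def v_def)
    define w where "w = - v - 3 * u / (1 + u\<^sup>2)"
    have "(1 + u\<^sup>2) * (v + w) = - 3 * u"
      by (simp add: w_def field_simps)
    then have "(1 + u\<^sup>2) * w\<^sup>2 + 3 * u * w + 2 * u\<^sup>2 - 1 = 0"
      using uv by algebra
    then show ?thesis
      using False r unfolding ratio_curve_def by (simp add: u_def w_def del: ratio.simps)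
  qed
qed

lemma ratio_sum:
  "ratio (Suc (Suc n)) + ratio n = - 3 * ratio (Suc n) / ((if odd n then 1 else 2) + (ratio (Suc n))\<^sup>2)"
  by simp

lemma ratio_rational: "ratio n \<in> \<rat>"
  by (induction n rule: ratio.induct) (auto intro!: Rats_diff Rats_divide Rats_mult Rats_add)

section \<open>Non-vanishing of the quotients\<close>

text \<open>Since 2 is not a square modulo 3, the equation forces 3 to divide both \<open>p\<close>
  and \<open>q\<close>, which is impossible once their gcd has been divided out.\<close>

lemma square_ratio_not_nonresidue_mod_3:
  fixes p q :: int
  assumes "p\<^sup>2 = 2 * q\<^sup>2 + 3 * k * q\<^sup>2" "q \<noteq> 0"
  shows False
proof -
  have *: "3 dvd p \<and> 3 dvd q" if "p\<^sup>2 = 2 * q\<^sup>2 + 3 * k * q\<^sup>2" for p q :: int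
  proof -
    have "p\<^sup>2 mod 3 = (2 * q\<^sup>2) mod 3"
      using that by (simp add: mult.assoc)
    then have "(p mod 3)\<^sup>2 mod 3 = (2 * (q mod 3)\<^sup>2) mod 3"
      by (metis mod_mult_right_eq power_mod)
    moreover have "p mod 3 = 0 \<or> p mod 3 = 1 \<or> p mod 3 = 2" "q mod 3 = 0 \<or> q mod 3 = 1 \<or> q mod 3 = 2"
      by presburger+
    ultimately show ?thesis by (elim disjE) (simp_all add: dvd_eq_mod_eq_0)
  qed
  define g where "g = gcd p q"
  have g: "g \<noteq> 0" using assms(2) by (simp add: g_def)
  obtain p' q' where pq: "p = p' * g" "q = q' * g" "coprime p' q'"
    using gcd_coprime_exists[of p q] g unfolding g_def by metis
  have "g\<^sup>2 * p'\<^sup>2 = g\<^sup>2 * (2 * q'\<^sup>2 + 3 * k * q'\<^sup>2)"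
    using assms(1) unfolding pq(1,2) by (simp add: power_mult_distrib algebra_simps)
  then have "p'\<^sup>2 = 2 * q'\<^sup>2 + 3 * k * q'\<^sup>2"
    using g by simp
  then have "3 dvd p'" "3 dvd q'" using * by auto
  then show False using pq(3) by (auto dest: coprime_common_divisor)
qed

text \<open>Serves both irrationalities below: k = 0 gives 2 and k = 5 gives 17.\<close>

lemma rational_square_mod_3:
  fixes x :: real
  assumes "x \<in> \<rat>"
  shows "x\<^sup>2 \<noteq> of_int (2 + 3 * k)"
proof
  assume x: "x\<^sup>2 = of_int (2 + 3 * k)"
  obtain p q :: int where pq: "q \<noteq> 0" "x = of_int p / of_int q"
    using assms by (metis Rats_cases' less_irrefl)
  have "of_int (p\<^sup>2) = (of_int (2 * q\<^sup>2 + 3 * k * q\<^sup>2) :: real)"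
    using x pq by (simp add: field_simps)
  then show False
    using square_ratio_not_nonresidue_mod_3[of p q k] pq(1) by (blast dest: of_int_eq_iff[THEN iffD1])
qed

text \<open>
  At a first zero \<open>N\<close> the recursion, being reversible and odd, makes the sequence (anti)symmetric about
  \<open>N / 2\<close>, so the biquadratic has a double root there; its discriminant forces \<open>\<surd>17\<close> to be rational.
  For odd \<open>N\<close> the biquadratic at \<open>v = 0\<close> already makes \<open>\<surd>2\<close> rational.
\<close>

lemma ratio_reflect:
  assumes N: "even N" "ratio N = 0" "ratio (N - 1) = e" "e = 1 \<or> e = -1" and "k \<le> N"
  shows "ratio (N - k) = e * ratio k"
  using \<open>k \<le> N\<close>
proof (induction k rule: ratio.induct)
  case 1
  then show ?case using N by simp
next
  case 2
  then show ?case using N by simp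
next
  case (3 n)
  define j where "j = N - Suc (Suc n)"
  have j: "N - Suc n = Suc j" "N - n = Suc (Suc j)" "odd j \<longleftrightarrow> odd n"
    using "3.prems" N(1) by (auto simp: j_def)
  have a: "ratio (Suc (Suc j)) = e * ratio n" "ratio (Suc j) = e * ratio (Suc n)"
    using 3 j by auto
  have e: "e\<^sup>2 = 1" using N(4) by auto
  have "ratio j + e * ratio n = e * (ratio (Suc (Suc n)) + ratio n)"
    using ratio_sum[of j] a j(3) e unfolding ratio_sum[of n]
    by (simp add: power_mult_distrib algebra_simps del: ratio.simps)
  then show ?case
    unfolding j_def[symmetric] by (simp add: algebra_simps del: ratio.simps)
qed

lemma ratio_nonzero:
  assumes "n \<noteq> 0"
  shows "ratio n \<noteq> 0"
  using assms
proof (induction n rule: less_induct)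
  case (less N)
  show ?case
  proof
    assume z: "ratio N = 0"
    obtain M where M: "N = Suc M" using less(2) by (cases N) auto
    show False
    proof (cases "even N")
      case False
      then have "even M" using M by simp
      then have "2 * (ratio M)\<^sup>2 = 1"
        using ratio_curve_even_odd[of M] z M by (simp add: ratio_curve_def)
      \<comment> \<open>Doubling turns the square 1/2 into 2, which has the excluded form.\<close>
      then have "(2 * ratio M)\<^sup>2 = of_int (2 + 3 * 0)" by (simp add: power_mult_distrib)
      moreover have "2 * ratio M \<in> \<rat>" using ratio_rational by auto
      ultimately show False using rational_square_mod_3 by blast
    next
      case True
      then have "(ratio M)\<^sup>2 = 1"
        using ratio_curve_even_odd[of M] z M by (simp add: ratio_curve_def)
      then have e: "ratio M = 1 \<or> ratio M = -1" by (simp add: power2_eq_1_iff)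
      obtain m where m: "N = 2 * Suc m"
        using True M by (metis dvdE mult_0_right nat.distinct(1) not0_implies_Suc)
      have refl: "ratio (N - k) = ratio M * ratio k" if "k \<le> N" for k
        by (rule ratio_reflect[OF True z _ e that]) (simp add: M)
      have nz: "ratio (Suc m) \<noteq> 0" using less(1)[of "Suc m"] m by auto
      \<comment> \<open>The midpoint \<open>Suc m\<close> is its own mirror image and its value is
        nonzero by minimality of \<open>N\<close>, so the sign is +1.\<close>
      have "ratio (Suc m) = ratio M * ratio (Suc m)" using refl[of "Suc m"] m by simp
      then have "ratio M = 1" using nz by simp
      then have eq: "ratio (Suc (Suc m)) = ratio m" using refl[of m] m by simp
      define x y where "x = ratio (Suc m)" and "y = ratio m"
      have rat: "x \<in> \<rat>" using ratio_rational by (simp add: x_def)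
      show False
      proof (cases "even m")
        case True
        have c: "ratio_curve y x" using ratio_curve_even_odd[of m] True by (simp add: x_def y_def)
        have s: "2 * y = - 3 * x / (2 + x\<^sup>2)"
          using ratio_sum[of m] eq True by (simp add: x_def y_def del: ratio.simps)
        have s': "2 * y * (2 + x\<^sup>2) = - 3 * x" unfolding s by simp
        \<comment> \<open>As \<open>y\<close> is a double root, the discriminant vanishes: 4 x^4 - 5
          x^2 - 8 = 0. Completing the square gives 153 = 9 * 17.\<close>
        have "((8 * x\<^sup>2 - 5) / 3)\<^sup>2 = of_int (2 + 3 * 5)"
        proof -
          have "(8 * x\<^sup>2 - 5)\<^sup>2 = 153"
            using c s' unfolding ratio_curve_def by algebra
          then show ?thesis by (simp add: power_divide)
        qed
        moreover have "(8 * x\<^sup>2 - 5) / 3 \<in> \<rat>" using rat by auto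
        ultimately show False using rational_square_mod_3 by blast
      next
        case False
        have c: "ratio_curve x y"
          using ratio_curve_even_odd[of m] False by (simp add: x_def y_def)
        have s: "2 * y = - 3 * x / (1 + x\<^sup>2)"
          using ratio_sum[of m] eq False by (simp add: x_def y_def del: ratio.simps)
        have s': "2 * y * (1 + x\<^sup>2) = - 3 * x" unfolding s by simp
        \<comment> \<open>Here the vanishing discriminant reads 8 x^4 - 5 x^2 - 4 = 0; completing
          the square yields 153 again.\<close>
        have "((16 * x\<^sup>2 - 5) / 3)\<^sup>2 = of_int (2 + 3 * 5)"
        proof -
          have "(16 * x\<^sup>2 - 5)\<^sup>2 = 153"
            using c s' unfolding ratio_curve_def by algebra
          then show ?thesis by (simp add: power_divide)
        qed
        moreover have "(16 * x\<^sup>2 - 5) / 3 \<in> \<rat>" using rat by auto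
        ultimately show False using rational_square_mod_3 by blast
      qed
    qed
  qed
qed

lemma tseq_nonzero: "n \<noteq> 0 \<Longrightarrow> tseq n \<noteq> 0"
  by (simp add: tseq_def ratio_nonzero)

section \<open>Bilinear relations and the Somos-5 recurrence\<close>

text \<open>The name refers to the central index \<open>Suc n\<close>. The last two relations are
  the sum and the product of the roots of the biquadratic, multiplied by the neighbouring values of
  \<open>sseq\<close>.\<close>

lemma neighbours_even:
  assumes "odd n"
  shows "sseq (Suc (Suc n)) * sseq n = (sseq (Suc n))\<^sup>2 + (tseq (Suc n))\<^sup>2"
    and "tseq (Suc (Suc n)) * sseq n + tseq n * sseq (Suc (Suc n)) = - 3 * (sseq (Suc n) * tseq (Suc n))"
    and "tseq (Suc (Suc n)) * tseq n = 2 * (tseq (Suc n))\<^sup>2 - (sseq (Suc n))\<^sup>2"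
proof -
  define s u v w where "s = sseq (Suc n)" and "u = ratio n" and "v = ratio (Suc n)" and "w = ratio (Suc (Suc n))"
  have 1: "sseq (Suc (Suc n)) * sseq n = s\<^sup>2 * (1 + v\<^sup>2)"
    using assms by (simp add: s_def v_def)
  have 2: "(w + u) * (1 + v\<^sup>2) = - 3 * v"
    using ratio_sum[of n] assms by (simp add: u_def v_def w_def del: ratio.simps)
  have 3: "(1 + v\<^sup>2) * u\<^sup>2 + 3 * v * u + 2 * v\<^sup>2 - 1 = 0"
    using ratio_curve_even_odd[of n] assms by (simp add: u_def v_def ratio_curve_def)
  have 4: "u * w * (1 + v\<^sup>2) = 2 * v\<^sup>2 - 1"
    using 2 3 by algebra
  show "sseq (Suc (Suc n)) * sseq n = (sseq (Suc n))\<^sup>2 + (tseq (Suc n))\<^sup>2"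
    unfolding 1 tseq_def s_def[symmetric] v_def[symmetric] by algebra
  show "tseq (Suc (Suc n)) * sseq n + tseq n * sseq (Suc (Suc n)) = - 3 * (sseq (Suc n) * tseq (Suc n))"
    using 1 2 unfolding tseq_def s_def[symmetric] u_def[symmetric] v_def[symmetric] w_def[symmetric] by algebra
  show "tseq (Suc (Suc n)) * tseq n = 2 * (tseq (Suc n))\<^sup>2 - (sseq (Suc n))\<^sup>2"
    using 1 4 unfolding tseq_def s_def[symmetric] u_def[symmetric] v_def[symmetric] w_def[symmetric] by algebra
qed

text \<open>The denominator 3 is kept on the left so that all coefficients are integers, ready for
  the later transfer to the integers.\<close>

lemma neighbours_odd:
  assumes "even n"
  shows "3 * (sseq (Suc (Suc n)) * sseq n) = 2 * (sseq (Suc n))\<^sup>2 + (tseq (Suc n))\<^sup>2"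
    and "tseq (Suc (Suc n)) * sseq n + tseq n * sseq (Suc (Suc n)) = - (sseq (Suc n) * tseq (Suc n))"
    and "3 * (tseq (Suc (Suc n)) * tseq n) = (tseq (Suc n))\<^sup>2 - (sseq (Suc n))\<^sup>2"
proof -
  define s u v w where "s = sseq (Suc n)" and "u = ratio n" and "v = ratio (Suc n)" and "w = ratio (Suc (Suc n))"
  have 1: "3 * (sseq (Suc (Suc n)) * sseq n) = s\<^sup>2 * (2 + v\<^sup>2)"
    using assms by (simp add: s_def v_def)
  have 2: "(w + u) * (2 + v\<^sup>2) = - 3 * v"
    using ratio_sum[of n] assms by (simp add: u_def v_def w_def del: ratio.simps)
  have 3: "(1 + u\<^sup>2) * v\<^sup>2 + 3 * u * v + 2 * u\<^sup>2 - 1 = 0"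
    using ratio_curve_even_odd[of n] assms by (simp add: u_def v_def ratio_curve_def)
  have 4: "u * w * (2 + v\<^sup>2) = v\<^sup>2 - 1"
    using 2 3 by algebra
  show "3 * (sseq (Suc (Suc n)) * sseq n) = 2 * (sseq (Suc n))\<^sup>2 + (tseq (Suc n))\<^sup>2"
    unfolding 1 tseq_def s_def[symmetric] v_def[symmetric] by algebra
  have "3 * (tseq (Suc (Suc n)) * sseq n + tseq n * sseq (Suc (Suc n))) = 3 * (- (sseq (Suc n) * tseq (Suc n)))"
    using 1 2 unfolding tseq_def s_def[symmetric] u_def[symmetric] v_def[symmetric] w_def[symmetric] by algebra
  then show "tseq (Suc (Suc n)) * sseq n + tseq n * sseq (Suc (Suc n)) = - (sseq (Suc n) * tseq (Suc n))"
    by simp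
  show "3 * (tseq (Suc (Suc n)) * tseq n) = (tseq (Suc n))\<^sup>2 - (sseq (Suc n))\<^sup>2"
    using 1 4 unfolding tseq_def s_def[symmetric] u_def[symmetric] v_def[symmetric] w_def[symmetric] by algebra
qed

text \<open>
  In the window lemmas \<open>(S, T)\<close> is the central pair, \<open>(A, B)\<close> and \<open>(C, D)\<close> are its right and left
  neighbours, and \<open>(S2, T2)\<close>, \<open>(R2, Q2)\<close> the pairs at distance two to the right and to the left.
\<close>

lemma window_even:
  fixes S T A B C D S2 T2 R2 Q2 :: real
  assumes "A * C = S\<^sup>2 + T\<^sup>2" "B * C + D * A = - 3 * (S * T)" "B * D = 2 * T\<^sup>2 - S\<^sup>2"
    and "3 * (S2 * S) = 2 * A\<^sup>2 + B\<^sup>2" "3 * (T2 * T) = B\<^sup>2 - A\<^sup>2"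
    and "3 * (S * R2) = 2 * C\<^sup>2 + D\<^sup>2" "3 * (T * Q2) = D\<^sup>2 - C\<^sup>2"
    and "S \<noteq> 0" "T \<noteq> 0"
  shows "S2 * R2 = S\<^sup>2 + 2 * T\<^sup>2" "T2 * Q2 = T\<^sup>2 - S\<^sup>2"
    and "R2 * T2 = D * A + S * T" "Q2 * S2 = B * C + S * T"
proof -
  have "9 * S\<^sup>2 * (S2 * R2) = 9 * S\<^sup>2 * (S\<^sup>2 + 2 * T\<^sup>2)"
  proof -
    have "9 * S\<^sup>2 * (S2 * R2) = (2 * A\<^sup>2 + B\<^sup>2) * (2 * C\<^sup>2 + D\<^sup>2)"
      using assms(4,6) by algebra
    \<comment> \<open>Symmetric under exchange of left and right, hence a polynomial in the three
      central expressions.\<close>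
    also have "\<dots> = 4 * (A * C)\<^sup>2 + (B * D)\<^sup>2 + 2 * (B * C + D * A)\<^sup>2 - 4 * (A * C) * (B * D)"
      by algebra
    also have "\<dots> = 9 * S\<^sup>2 * (S\<^sup>2 + 2 * T\<^sup>2)"
      unfolding assms(1-3) by algebra
    finally show ?thesis .
  qed
  then show "S2 * R2 = S\<^sup>2 + 2 * T\<^sup>2" using assms(8) by simp
  have "9 * T\<^sup>2 * (T2 * Q2) = 9 * T\<^sup>2 * (T\<^sup>2 - S\<^sup>2)"
  proof -
    have "9 * T\<^sup>2 * (T2 * Q2) = (B\<^sup>2 - A\<^sup>2) * (D\<^sup>2 - C\<^sup>2)"
      using assms(5,7) by algebra
    also have "\<dots> = (A * C)\<^sup>2 + (B * D)\<^sup>2 - (B * C + D * A)\<^sup>2 + 2 * (A * C) * (B * D)"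
      by algebra
    also have "\<dots> = 9 * T\<^sup>2 * (T\<^sup>2 - S\<^sup>2)"
      unfolding assms(1-3) by algebra
    finally show ?thesis .
  qed
  then show "T2 * Q2 = T\<^sup>2 - S\<^sup>2" using assms(9) by simp
  have "9 * (S * T) * (R2 * T2) = 9 * (S * T) * (D * A + S * T)"
  proof -
    have "9 * (S * T) * (R2 * T2) = (2 * C\<^sup>2 + D\<^sup>2) * (B\<^sup>2 - A\<^sup>2)"
      using assms(5,6) by algebra
    \<comment> \<open>Not symmetric in left and right, so \<open>D * A\<close> survives; its square
      is eliminated through the known sum and product of \<open>B * C\<close> and
      \<open>D * A\<close>.\<close>
    also have "\<dots> = 9 * (S * T) * (D * A + S * T)"
      using assms(1-3) by algebra
    finally show ?thesis .
  qed
  then show "R2 * T2 = D * A + S * T" using assms(8,9) by simp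
  have "9 * (S * T) * (Q2 * S2) = 9 * (S * T) * (B * C + S * T)"
  proof -
    have "9 * (S * T) * (Q2 * S2) = (2 * A\<^sup>2 + B\<^sup>2) * (D\<^sup>2 - C\<^sup>2)"
      using assms(4,7) by algebra
    also have "\<dots> = 9 * (S * T) * (B * C + S * T)"
      using assms(1-3) by algebra
    finally show ?thesis .
  qed
  then show "Q2 * S2 = B * C + S * T" using assms(8,9) by simp
qed

lemma window_odd:
  fixes S T A B C D S2 T2 R2 Q2 :: real
  assumes "3 * (A * C) = 2 * S\<^sup>2 + T\<^sup>2" "B * C + D * A = - (S * T)" "3 * (B * D) = T\<^sup>2 - S\<^sup>2"
    and "S2 * S = A\<^sup>2 + B\<^sup>2" "T2 * T = 2 * B\<^sup>2 - A\<^sup>2"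
    and "S * R2 = C\<^sup>2 + D\<^sup>2" "T * Q2 = 2 * D\<^sup>2 - C\<^sup>2"
    and "S \<noteq> 0" "T \<noteq> 0"
  shows "S2 * R2 = S\<^sup>2 + T\<^sup>2" "T2 * Q2 = T\<^sup>2 - 2 * S\<^sup>2"
    and "R2 * T2 = 3 * (D * A) + S * T" "Q2 * S2 = 3 * (B * C) + S * T"
proof -
  have "9 * S\<^sup>2 * (S2 * R2) = 9 * ((A\<^sup>2 + B\<^sup>2) * (C\<^sup>2 + D\<^sup>2))"
    using assms(4,6) by algebra
  also have "\<dots> = 9 * S\<^sup>2 * (S\<^sup>2 + T\<^sup>2)"
    using assms(1-3) by algebra
  finally show "S2 * R2 = S\<^sup>2 + T\<^sup>2" using assms(8) by simp
  have "9 * T\<^sup>2 * (T2 * Q2) = 9 * ((2 * B\<^sup>2 - A\<^sup>2) * (2 * D\<^sup>2 - C\<^sup>2))"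
    using assms(5,7) by algebra
  also have "\<dots> = 9 * T\<^sup>2 * (T\<^sup>2 - 2 * S\<^sup>2)"
    using assms(1-3) by algebra
  finally show "T2 * Q2 = T\<^sup>2 - 2 * S\<^sup>2" using assms(9) by simp
  have "9 * (S * T) * (R2 * T2) = 9 * ((C\<^sup>2 + D\<^sup>2) * (2 * B\<^sup>2 - A\<^sup>2))"
    using assms(5,6) by algebra
  also have "\<dots> = 9 * (S * T) * (3 * (D * A) + S * T)"
    using assms(1-3) by algebra
  finally show "R2 * T2 = 3 * (D * A) + S * T" using assms(8,9) by simp
  have "9 * (S * T) * (Q2 * S2) = 9 * ((A\<^sup>2 + B\<^sup>2) * (2 * D\<^sup>2 - C\<^sup>2))"
    using assms(4,7) by algebra
  also have "\<dots> = 9 * (S * T) * (3 * (B * C) + S * T)"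
    using assms(1-3) by algebra
  finally show "Q2 * S2 = 3 * (B * C) + S * T" using assms(8,9) by simp
qed

lemma add_numeral_Suc:
  "n + 2 = Suc (Suc n)" "n + 3 = Suc (Suc (Suc n))" "n + 4 = Suc (Suc (Suc (Suc n)))"
  "n + 5 = Suc (Suc (Suc (Suc (Suc n))))"
  by simp_all

declare ratio.simps [simp del] sseq.simps [simp del]

text \<open>The first two relations feed Somos-5, integrality and coprimality at distance two; the
  last two, which mix the sequences, feed the triangle identities.\<close>

lemma two_step_even:
  assumes "even n"
  shows "sseq (n + 4) * sseq n = (sseq (n + 2))\<^sup>2 + 2 * (tseq (n + 2))\<^sup>2"
    and "tseq (n + 4) * tseq n = (tseq (n + 2))\<^sup>2 - (sseq (n + 2))\<^sup>2"
    and "sseq n * tseq (n + 4) = tseq (n + 1) * sseq (n + 3) + sseq (n + 2) * tseq (n + 2)"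
    and "tseq n * sseq (n + 4) = tseq (n + 3) * sseq (n + 1) + sseq (n + 2) * tseq (n + 2)"
proof -
  note mid = neighbours_even[of "Suc n"] and right = neighbours_odd[of "Suc (Suc n)"]
    and left = neighbours_odd[of n]
  note w = window_even[OF mid right(1,3) left(1,3) sseq_nonzero tseq_nonzero]
  show "sseq (n + 4) * sseq n = (sseq (n + 2))\<^sup>2 + 2 * (tseq (n + 2))\<^sup>2"
    and "tseq (n + 4) * tseq n = (tseq (n + 2))\<^sup>2 - (sseq (n + 2))\<^sup>2"
    and "sseq n * tseq (n + 4) = tseq (n + 1) * sseq (n + 3) + sseq (n + 2) * tseq (n + 2)"
    and "tseq n * sseq (n + 4) = tseq (n + 3) * sseq (n + 1) + sseq (n + 2) * tseq (n + 2)"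
    using w assms by (simp_all add: add_numeral_Suc)
qed

lemma two_step_odd:
  assumes "odd n"
  shows "sseq (n + 4) * sseq n = (sseq (n + 2))\<^sup>2 + (tseq (n + 2))\<^sup>2"
    and "tseq (n + 4) * tseq n = (tseq (n + 2))\<^sup>2 - 2 * (sseq (n + 2))\<^sup>2"
    and "sseq n * tseq (n + 4) = 3 * (tseq (n + 1) * sseq (n + 3)) + sseq (n + 2) * tseq (n + 2)"
    and "tseq n * sseq (n + 4) = 3 * (tseq (n + 3) * sseq (n + 1)) + sseq (n + 2) * tseq (n + 2)"
proof -
  note mid = neighbours_odd[of "Suc n"] and right = neighbours_even[of "Suc (Suc n)"]
    and left = neighbours_even[of n]
  note w = window_odd[OF mid right(1,3) left(1,3) sseq_nonzero tseq_nonzero]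
  show "sseq (n + 4) * sseq n = (sseq (n + 2))\<^sup>2 + (tseq (n + 2))\<^sup>2"
    and "tseq (n + 4) * tseq n = (tseq (n + 2))\<^sup>2 - 2 * (sseq (n + 2))\<^sup>2"
    and "sseq n * tseq (n + 4) = 3 * (tseq (n + 1) * sseq (n + 3)) + sseq (n + 2) * tseq (n + 2)"
    and "tseq n * sseq (n + 4) = 3 * (tseq (n + 3) * sseq (n + 1)) + sseq (n + 2) * tseq (n + 2)"
    using w assms by (simp_all add: add_numeral_Suc)
qed

section \<open>The Somos-5 recurrence from the biquadratic\<close>

text \<open>The equation of \<open>ratio_curve\<close> for T / S and B / A, cleared of denominators;
  (S, T) is the pair of even index.\<close>

definition pair_curve :: "real \<Rightarrow> real \<Rightarrow> real \<Rightarrow> real \<Rightarrow> bool" where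
  "pair_curve S T A B \<longleftrightarrow> (S\<^sup>2 + T\<^sup>2) * B\<^sup>2 + 3 * (S * T * A * B) + (2 * T\<^sup>2 - S\<^sup>2) * A\<^sup>2 = 0"

lemma pair_curve_neighbours:
  "even n \<Longrightarrow> pair_curve (sseq n) (tseq n) (sseq (Suc n)) (tseq (Suc n))"
  "odd n \<Longrightarrow> pair_curve (sseq (Suc n)) (tseq (Suc n)) (sseq n) (tseq n)"
proof -
  have *: "pair_curve S (u * S) A (v * A)" if "ratio_curve u v" for S A u v
    using that unfolding ratio_curve_def pair_curve_def by algebra
  show "even n \<Longrightarrow> pair_curve (sseq n) (tseq n) (sseq (Suc n)) (tseq (Suc n))"
    "odd n \<Longrightarrow> pair_curve (sseq (Suc n)) (tseq (Suc n)) (sseq n) (tseq n)"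
    using *[of "ratio n" "ratio (Suc n)"] *[of "ratio (Suc n)" "ratio n"] ratio_curve_even_odd[of n]
    by (simp_all add: tseq_def)
qed

text \<open>\<open>X\<close> and \<open>Y\<close> stand for S (n + 4) S (n + 1) and S (n + 5) S n.
  Since X (S A) and Y X are known forms, the claim multiplied by \<open>X\<close>, that is X^2 + X
  (S A) = Y X, reduces to the curve equation.\<close>

lemma pair_curve_somos_S:
  assumes "pair_curve S T A B" "3 * X * (S * A) = (2 * A\<^sup>2 + B\<^sup>2) * (S\<^sup>2 + T\<^sup>2)"
    and "Y * X = (A\<^sup>2 + B\<^sup>2) * (S\<^sup>2 + 2 * T\<^sup>2)" "S \<noteq> 0" "A \<noteq> 0" "X \<noteq> 0"
  shows "Y = X + S * A"
proof -
  have "(3 * X * (S * A))\<^sup>2 + 3 * (3 * X * (S * A)) * (S * A)\<^sup>2 = 9 * (S * A)\<^sup>2 * ((A\<^sup>2 + B\<^sup>2) * (S\<^sup>2 + 2 * T\<^sup>2))"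
    using assms(1) unfolding assms(2) pair_curve_def by algebra
  then have "9 * (S * A)\<^sup>2 * X * (X + S * A) = 9 * (S * A)\<^sup>2 * X * Y"
    using assms(3) by algebra
  then show ?thesis using assms(4-6) by simp
qed

lemma pair_curve_somos_T:
  assumes "pair_curve S T A B" "3 * X * (T * B) = (2 * T\<^sup>2 - S\<^sup>2) * (B\<^sup>2 - A\<^sup>2)"
    and "Y * X = (T\<^sup>2 - S\<^sup>2) * (B\<^sup>2 - 2 * A\<^sup>2)" "T \<noteq> 0" "B \<noteq> 0" "X \<noteq> 0"
  shows "Y = X + T * B"
proof -
  have "(3 * X * (T * B))\<^sup>2 + 3 * (3 * X * (T * B)) * (T * B)\<^sup>2 = 9 * (T * B)\<^sup>2 * ((T\<^sup>2 - S\<^sup>2) * (B\<^sup>2 - 2 * A\<^sup>2))"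
    using assms(1) unfolding assms(2) pair_curve_def by algebra
  then have "9 * (T * B)\<^sup>2 * X * (X + T * B) = 9 * (T * B)\<^sup>2 * X * Y"
    using assms(3) by algebra
  then show ?thesis using assms(4-6) by simp
qed

lemma sseq_somos: "sseq (n + 5) * sseq n = sseq (n + 4) * sseq (n + 1) + sseq (n + 3) * sseq (n + 2)"
proof (cases "even n")
  case True
  have 1: "sseq (n + 3) * sseq (n + 1) = (sseq (n + 2))\<^sup>2 + (tseq (n + 2))\<^sup>2"
    using neighbours_even(1)[of "Suc n"] True by (simp add: add_numeral_Suc)
  have 2: "3 * (sseq (n + 4) * sseq (n + 2)) = 2 * (sseq (n + 3))\<^sup>2 + (tseq (n + 3))\<^sup>2"
    using neighbours_odd(1)[of "n + 2"] True by (simp add: add_numeral_Suc)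
  have 3: "sseq (n + 4) * sseq n = (sseq (n + 2))\<^sup>2 + 2 * (tseq (n + 2))\<^sup>2"
    using two_step_even(1)[OF True] .
  have 4: "sseq (n + 5) * sseq (n + 1) = (sseq (n + 3))\<^sup>2 + (tseq (n + 3))\<^sup>2"
    using two_step_odd(1)[of "Suc n"] True by (simp add: add_numeral_Suc)
  have 5: "pair_curve (sseq (n + 2)) (tseq (n + 2)) (sseq (n + 3)) (tseq (n + 3))"
    using pair_curve_neighbours(1)[of "n + 2"] True by (simp add: add_numeral_Suc)
  have 6: "3 * (sseq (n + 4) * sseq (n + 1)) * (sseq (n + 2) * sseq (n + 3)) =
      (2 * (sseq (n + 3))\<^sup>2 + (tseq (n + 3))\<^sup>2) * ((sseq (n + 2))\<^sup>2 + (tseq (n + 2))\<^sup>2)"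
    using 1 2 by algebra
  have 7: "(sseq (n + 5) * sseq n) * (sseq (n + 4) * sseq (n + 1)) =
      ((sseq (n + 3))\<^sup>2 + (tseq (n + 3))\<^sup>2) * ((sseq (n + 2))\<^sup>2 + 2 * (tseq (n + 2))\<^sup>2)"
    using 3 4 by algebra
  show ?thesis
    using pair_curve_somos_S[OF 5 6 7] by (simp add: mult.commute)
next
  case False
  have 1: "3 * (sseq (n + 3) * sseq (n + 1)) = 2 * (sseq (n + 2))\<^sup>2 + (tseq (n + 2))\<^sup>2"
    using neighbours_odd(1)[of "Suc n"] False by (simp add: add_numeral_Suc)
  have 2: "sseq (n + 4) * sseq (n + 2) = (sseq (n + 3))\<^sup>2 + (tseq (n + 3))\<^sup>2"
    using neighbours_even(1)[of "n + 2"] False by (simp add: add_numeral_Suc)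
  have 3: "sseq (n + 4) * sseq n = (sseq (n + 2))\<^sup>2 + (tseq (n + 2))\<^sup>2"
    using two_step_odd(1)[OF False] .
  have 4: "sseq (n + 5) * sseq (n + 1) = (sseq (n + 3))\<^sup>2 + 2 * (tseq (n + 3))\<^sup>2"
    using two_step_even(1)[of "Suc n"] False by (simp add: add_numeral_Suc)
  \<comment> \<open>For odd \<open>n\<close> the even index of the middle pair is n + 3, so the two
    pairs change roles.\<close>
  have 5: "pair_curve (sseq (n + 3)) (tseq (n + 3)) (sseq (n + 2)) (tseq (n + 2))"
    using pair_curve_neighbours(2)[of "n + 2"] False by (simp add: add_numeral_Suc)
  have 6: "3 * (sseq (n + 4) * sseq (n + 1)) * (sseq (n + 3) * sseq (n + 2)) =
      (2 * (sseq (n + 2))\<^sup>2 + (tseq (n + 2))\<^sup>2) * ((sseq (n + 3))\<^sup>2 + (tseq (n + 3))\<^sup>2)"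
    using 1 2 by algebra
  have 7: "(sseq (n + 5) * sseq n) * (sseq (n + 4) * sseq (n + 1)) =
      ((sseq (n + 2))\<^sup>2 + (tseq (n + 2))\<^sup>2) * ((sseq (n + 3))\<^sup>2 + 2 * (tseq (n + 3))\<^sup>2)"
    using 3 4 by algebra
  show ?thesis
    using pair_curve_somos_S[OF 5 6 7] by (simp add: mult.commute)
qed

lemma tseq_somos:
  assumes "0 < n"
  shows "tseq (n + 5) * tseq n = tseq (n + 4) * tseq (n + 1) + tseq (n + 3) * tseq (n + 2)"
proof (cases "even n")
  case True
  have 1: "tseq (n + 3) * tseq (n + 1) = 2 * (tseq (n + 2))\<^sup>2 - (sseq (n + 2))\<^sup>2"
    using neighbours_even(3)[of "Suc n"] True by (simp add: add_numeral_Suc)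
  have 2: "3 * (tseq (n + 4) * tseq (n + 2)) = (tseq (n + 3))\<^sup>2 - (sseq (n + 3))\<^sup>2"
    using neighbours_odd(3)[of "n + 2"] True by (simp add: add_numeral_Suc)
  have 3: "tseq (n + 4) * tseq n = (tseq (n + 2))\<^sup>2 - (sseq (n + 2))\<^sup>2"
    using two_step_even(2)[OF True] .
  have 4: "tseq (n + 5) * tseq (n + 1) = (tseq (n + 3))\<^sup>2 - 2 * (sseq (n + 3))\<^sup>2"
    using two_step_odd(2)[of "Suc n"] True by (simp add: add_numeral_Suc)
  have 5: "pair_curve (sseq (n + 2)) (tseq (n + 2)) (sseq (n + 3)) (tseq (n + 3))"
    using pair_curve_neighbours(1)[of "n + 2"] True by (simp add: add_numeral_Suc)
  have 6: "3 * (tseq (n + 4) * tseq (n + 1)) * (tseq (n + 2) * tseq (n + 3)) =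
      (2 * (tseq (n + 2))\<^sup>2 - (sseq (n + 2))\<^sup>2) * ((tseq (n + 3))\<^sup>2 - (sseq (n + 3))\<^sup>2)"
    using 1 2 by algebra
  have 7: "(tseq (n + 5) * tseq n) * (tseq (n + 4) * tseq (n + 1)) =
      ((tseq (n + 2))\<^sup>2 - (sseq (n + 2))\<^sup>2) * ((tseq (n + 3))\<^sup>2 - 2 * (sseq (n + 3))\<^sup>2)"
    using 3 4 by algebra
  show ?thesis
    using pair_curve_somos_T[OF 5 6 7] assms by (simp add: mult.commute tseq_nonzero)
next
  case False
  have 1: "3 * (tseq (n + 3) * tseq (n + 1)) = (tseq (n + 2))\<^sup>2 - (sseq (n + 2))\<^sup>2"
    using neighbours_odd(3)[of "Suc n"] False by (simp add: add_numeral_Suc)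
  have 2: "tseq (n + 4) * tseq (n + 2) = 2 * (tseq (n + 3))\<^sup>2 - (sseq (n + 3))\<^sup>2"
    using neighbours_even(3)[of "n + 2"] False by (simp add: add_numeral_Suc)
  have 3: "tseq (n + 4) * tseq n = (tseq (n + 2))\<^sup>2 - 2 * (sseq (n + 2))\<^sup>2"
    using two_step_odd(2)[OF False] .
  have 4: "tseq (n + 5) * tseq (n + 1) = (tseq (n + 3))\<^sup>2 - (sseq (n + 3))\<^sup>2"
    using two_step_even(2)[of "Suc n"] False by (simp add: add_numeral_Suc)
  have 5: "pair_curve (sseq (n + 3)) (tseq (n + 3)) (sseq (n + 2)) (tseq (n + 2))"
    using pair_curve_neighbours(2)[of "n + 2"] False by (simp add: add_numeral_Suc)
  have 6: "3 * (tseq (n + 4) * tseq (n + 1)) * (tseq (n + 3) * tseq (n + 2)) =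
      (2 * (tseq (n + 3))\<^sup>2 - (sseq (n + 3))\<^sup>2) * ((tseq (n + 2))\<^sup>2 - (sseq (n + 2))\<^sup>2)"
    using 1 2 by algebra
  have 7: "(tseq (n + 5) * tseq n) * (tseq (n + 4) * tseq (n + 1)) =
      ((tseq (n + 3))\<^sup>2 - (sseq (n + 3))\<^sup>2) * ((tseq (n + 2))\<^sup>2 - 2 * (sseq (n + 2))\<^sup>2)"
    using 3 4 by algebra
  show ?thesis
    using pair_curve_somos_T[OF 5 6 7] assms by (simp add: mult.commute tseq_nonzero)
qed

lemma seq_values:
  "sseq 0 = 1" "sseq 1 = 1" "sseq 2 = 1" "sseq 3 = 2" "sseq 4 = 3" "sseq 5 = 5"
  "tseq 0 = 0" "tseq 1 = 1" "tseq 2 = -1" "tseq 3 = 1" "tseq 4 = 1" "tseq 5 = -7"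
proof -
  \<comment> \<open>Settles the parity test for 3 after the numerals have become unary.\<close>
  have [simp]: "\<not> Suc (Suc 0) dvd Suc (Suc (Suc 0))" by presburger
  show "sseq 0 = 1" "sseq 1 = 1" "sseq 2 = 1" "sseq 3 = 2" "sseq 4 = 3" "sseq 5 = 5"
    "tseq 0 = 0" "tseq 1 = 1" "tseq 2 = -1" "tseq 3 = 1" "tseq 4 = 1" "tseq 5 = -7"
    by (simp_all add: eval_nat_numeral sseq.simps ratio.simps tseq_def power_divide)
qed

section \<open>Identification with the given sequences\<close>

lemma somos_S_eq: "somos_S (int n) = sseq n"
proof (induction n rule: less_induct)
  case (less n)
  have v: "somos_S 0 = 1" "somos_S 1 = 1" "somos_S 2 = 1" "somos_S 3 = 2" "somos_S 4 = 3"
    using somos_S_values by (simp_all add: upto.simps)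
  consider "n = 0" | "n = 1" | "n = 2" | "n = 3" | "n = 4" | m where "n = m + 5"
  proof (cases "n < 5")
    case True
    then have "n = 0 \<or> n = 1 \<or> n = 2 \<or> n = 3 \<or> n = 4" by arith
    then show thesis using that(1-5) by blast
  next
    case False
    then show thesis using that(6)[of "n - 5"] by simp
  qed
  then show ?case
  proof cases
    case 6
    have "somos_S (int (m + 5)) * sseq m = sseq (m + 5) * sseq m"
      using somos_S_recurrence[of "int m"] sseq_somos[of m]
        less[of m] less[of "m + 1"] less[of "m + 2"] less[of "m + 3"] less[of "m + 4"] 6
      by (simp add: algebra_simps)
    then show ?thesis using 6 by simp
  qed (use v seq_values in simp_all)
qed

text \<open>Six initial values instead of five: as T 0 = 0, the recurrence determines term m + 5
  only for m > 0, where \<open>tseq_nonzero\<close> permits the division.\<close>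

lemma somos_T_eq: "somos_T (int n) = tseq n"
proof (induction n rule: less_induct)
  case (less n)
  have v: "somos_T 0 = 0" "somos_T 1 = 1" "somos_T 2 = -1" "somos_T 3 = 1" "somos_T 4 = 1" "somos_T 5 = -7"
    using somos_T_values by (simp_all add: upto.simps)
  consider "n = 0" | "n = 1" | "n = 2" | "n = 3" | "n = 4" | "n = 5" | m where "n = m + 5" "0 < m"
  proof (cases "n < 6")
    case True
    then have "n = 0 \<or> n = 1 \<or> n = 2 \<or> n = 3 \<or> n = 4 \<or> n = 5" by arith
    then show thesis using that(1-6) by blast
  next
    case False
    then show thesis using that(7)[of "n - 5"] by simp
  qed
  then show ?case
  proof cases
    case 7
    then have "somos_T (int (m + 5)) * tseq m = tseq (m + 5) * tseq m"
      using somos_T_recurrence[of "int m"] tseq_somos[of m] tseq_nonzero[of m]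
        less[of m] less[of "m + 1"] less[of "m + 2"] less[of "m + 3"] less[of "m + 4"]
      by (simp add: algebra_simps)
    then show ?thesis using 7 tseq_nonzero[of m] by simp
  qed (use v seq_values in simp_all)
qed

section \<open>Integrality and coprimality\<close>

lemma coprime_intI_prime:
  fixes a b :: int
  assumes "\<And>p. prime p \<Longrightarrow> p dvd a \<Longrightarrow> p dvd b \<Longrightarrow> False"
  shows "coprime a b"
proof (rule ccontr)
  assume "\<not> coprime a b"
  then have "\<not> is_unit (gcd a b)" by (simp add: coprime_iff_gcd_eq_1)
  \<comment> \<open>If both numbers were zero, the prime 2 would divide them.\<close>
  moreover have "gcd a b \<noteq> 0" using assms[of 2] by auto
  ultimately obtain p where "prime p" "p dvd gcd a b"
    using prime_divisor_exists by metis
  then show False using assms by auto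
qed

text \<open>The two forms add up to 3 t^2, so only p = 3 needs care; there a sum of two squares
  vanishes modulo 3 only if both squares do.\<close>

lemma prime_dvd_sum_two_squares_and_twice_minus:
  fixes p s t :: int
  assumes "prime p" "p dvd s\<^sup>2 + t\<^sup>2" "p dvd 2 * t\<^sup>2 - s\<^sup>2"
  shows "p dvd s" "p dvd t"
proof -
  have "p dvd 3 * t\<^sup>2" using dvd_add[OF assms(2,3)] by simp
  then have "p dvd 3 \<or> p dvd t"
    using assms(1) by (simp add: prime_dvd_mult_iff prime_dvd_power_iff)
  moreover have "p dvd t" if "p dvd 3"
  proof -
    have "prime (3::int)" by simp
    then have "p = 3" using that assms(1) primes_dvd_imp_eq by blast
    then have "(s\<^sup>2 + t\<^sup>2) mod 3 = 0" using assms(2) by (simp add: dvd_eq_mod_eq_0)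
    then have "((s mod 3)\<^sup>2 + (t mod 3)\<^sup>2) mod 3 = 0"
      by (metis mod_add_eq power_mod)
    moreover have "s mod 3 = 0 \<or> s mod 3 = 1 \<or> s mod 3 = 2" "t mod 3 = 0 \<or> t mod 3 = 1 \<or> t mod 3 = 2"
      by presburger+
    ultimately show ?thesis using \<open>p = 3\<close> by (elim disjE) (simp_all add: dvd_eq_mod_eq_0)
  qed
  ultimately show t: "p dvd t" by blast
  then have "p dvd t\<^sup>2" by (simp add: power2_eq_square)
  then have "p dvd s\<^sup>2" using assms(2) dvd_add_left_iff by blast
  then show "p dvd s" using assms(1) prime_dvd_power by blast
qed

text \<open>
  Coprimality of consecutive terms is needed while proving integrality, hence the relations are
  transferred to the integers only up to a bound.
\<close>

locale integral_prefix =
  fixes s t :: "nat \<Rightarrow> int" and N :: nat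
  assumes sseq_of_int: "n \<le> N \<Longrightarrow> sseq n = of_int (s n)"
    and tseq_of_int: "n \<le> N \<Longrightarrow> tseq n = of_int (t n)"
begin

lemma int_neighbours_even:
  assumes "odd n" "Suc (Suc n) \<le> N"
  shows "s (Suc (Suc n)) * s n = (s (Suc n))\<^sup>2 + (t (Suc n))\<^sup>2"
    and "t (Suc (Suc n)) * s n + t n * s (Suc (Suc n)) = - 3 * (s (Suc n) * t (Suc n))"
    and "t (Suc (Suc n)) * t n = 2 * (t (Suc n))\<^sup>2 - (s (Suc n))\<^sup>2"
proof -
  have "real_of_int (s (Suc (Suc n)) * s n) = of_int ((s (Suc n))\<^sup>2 + (t (Suc n))\<^sup>2)"
    "real_of_int (t (Suc (Suc n)) * s n + t n * s (Suc (Suc n))) = of_int (- 3 * (s (Suc n) * t (Suc n)))"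
    "real_of_int (t (Suc (Suc n)) * t n) = of_int (2 * (t (Suc n))\<^sup>2 - (s (Suc n))\<^sup>2)"
    using neighbours_even[OF assms(1)] assms(2) by (simp_all add: sseq_of_int tseq_of_int)
  then show "s (Suc (Suc n)) * s n = (s (Suc n))\<^sup>2 + (t (Suc n))\<^sup>2"
    "t (Suc (Suc n)) * s n + t n * s (Suc (Suc n)) = - 3 * (s (Suc n) * t (Suc n))"
    "t (Suc (Suc n)) * t n = 2 * (t (Suc n))\<^sup>2 - (s (Suc n))\<^sup>2"
    by (simp_all only: of_int_eq_iff)
qed

lemma int_neighbours_odd:
  assumes "even n" "Suc (Suc n) \<le> N"
  shows "3 * (s (Suc (Suc n)) * s n) = 2 * (s (Suc n))\<^sup>2 + (t (Suc n))\<^sup>2"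
    and "t (Suc (Suc n)) * s n + t n * s (Suc (Suc n)) = - (s (Suc n) * t (Suc n))"
    and "3 * (t (Suc (Suc n)) * t n) = (t (Suc n))\<^sup>2 - (s (Suc n))\<^sup>2"
proof -
  have "real_of_int (3 * (s (Suc (Suc n)) * s n)) = of_int (2 * (s (Suc n))\<^sup>2 + (t (Suc n))\<^sup>2)"
    "real_of_int (t (Suc (Suc n)) * s n + t n * s (Suc (Suc n))) = of_int (- (s (Suc n) * t (Suc n)))"
    "real_of_int (3 * (t (Suc (Suc n)) * t n)) = of_int ((t (Suc n))\<^sup>2 - (s (Suc n))\<^sup>2)"
    using neighbours_odd[OF assms(1)] assms(2) by (simp_all add: sseq_of_int tseq_of_int)
  then show "3 * (s (Suc (Suc n)) * s n) = 2 * (s (Suc n))\<^sup>2 + (t (Suc n))\<^sup>2"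
    "t (Suc (Suc n)) * s n + t n * s (Suc (Suc n)) = - (s (Suc n) * t (Suc n))"
    "3 * (t (Suc (Suc n)) * t n) = (t (Suc n))\<^sup>2 - (s (Suc n))\<^sup>2"
    by (simp_all only: of_int_eq_iff)
qed

lemma int_values:
  "s 0 = 1" "t 0 = 0" "1 \<le> N \<Longrightarrow> s 1 = 1" "1 \<le> N \<Longrightarrow> t 1 = 1"
  using sseq_of_int[of 0] tseq_of_int[of 0] sseq_of_int[of 1] tseq_of_int[of 1] seq_values by simp_all

text \<open>Descent: a prime dividing both terms of index \<open>n\<close> divides both terms of
  index n - 1, and finally \<open>s 1 = 1\<close>.\<close>

lemma prime_not_dvd_both:
  assumes "prime p" "n \<le> N"
  shows "\<not> (p dvd s n \<and> p dvd t n)"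
  using assms(2)
proof (induction n rule: less_induct)
  case (less n)
  consider "n = 0" | "n = 1" | m where "n = Suc (Suc m)" by (metis One_nat_def not0_implies_Suc)
  then show ?case
  proof cases
    case 3
    show ?thesis
    proof
      assume p: "p dvd s n \<and> p dvd t n"
      have "p dvd s (Suc m) \<and> p dvd t (Suc m)"
      proof (cases "even m")
        case True
        note i = int_neighbours_odd[OF True less.prems[unfolded 3]]
        \<comment> \<open>Solving the two product relations for the squares cancels the factor 3, so
          p = 3 is no exception here.\<close>
        have "(s (Suc m))\<^sup>2 = s n * s m - t n * t m" "(t (Suc m))\<^sup>2 = s n * s m + 2 * (t n * t m)"
          using i(1,3) 3 by auto
        then have "p dvd (s (Suc m))\<^sup>2" "p dvd (t (Suc m))\<^sup>2" using p by auto
        then show ?thesis using assms(1) prime_dvd_power by blast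
      next
        case False
        note i = int_neighbours_even[OF False less.prems[unfolded 3]]
        have "p dvd (s (Suc m))\<^sup>2 + (t (Suc m))\<^sup>2" "p dvd 2 * (t (Suc m))\<^sup>2 - (s (Suc m))\<^sup>2"
          using p 3 by (simp_all flip: i(1,3))
        then show ?thesis using prime_dvd_sum_two_squares_and_twice_minus[OF assms(1)] by blast
      qed
      then show False using less.IH[of "Suc m"] less.prems 3 by simp
    qed
  qed (use int_values assms(1) less.prems in auto)
qed

text \<open>Each product relation centred at \<open>n\<close> makes such a prime divide the other
  term of index \<open>n\<close> as well, against \<open>prime_not_dvd_both\<close>. Only a
  coefficient 2 in front of that term's square lets p = 2 escape.\<close>

lemma prime_not_dvd_consecutive:
  assumes p: "prime p" and "Suc n \<le> N"
  shows "\<not> (p dvd s n \<and> p dvd s (Suc n))" "\<not> (p dvd t n \<and> p dvd t (Suc n))"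
    and "p dvd s n \<and> p dvd t (Suc n) \<Longrightarrow> even n \<and> p = 2"
    and "p dvd t n \<and> p dvd s (Suc n) \<Longrightarrow> odd n \<and> p = 2"
proof -
  have both: "p dvd s n \<Longrightarrow> \<not> p dvd t n" using prime_not_dvd_both[OF p] assms(2) by simp
  have sq: "p dvd x\<^sup>2 \<longleftrightarrow> p dvd x" for x :: int
    using p by (simp add: prime_dvd_power_iff)
  have two: "p dvd 2 * x \<longleftrightarrow> p dvd x \<or> p = 2" for x :: int
    using p primes_dvd_imp_eq[of p 2] by (auto simp: prime_dvd_mult_iff)
  have "\<not> (p dvd s n \<and> p dvd s (Suc n)) \<and> \<not> (p dvd t n \<and> p dvd t (Suc n)) \<and>
    (p dvd s n \<and> p dvd t (Suc n) \<longrightarrow> even n \<and> p = 2) \<and> (p dvd t n \<and> p dvd s (Suc n) \<longrightarrow> odd n \<and> p = 2)"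
  proof (cases n)
    case 0
    then show ?thesis using int_values assms p by auto
  next
    case (Suc m)
    show ?thesis
    proof (cases "even m")
      case True
      note i = int_neighbours_odd[OF True, unfolded Suc[symmetric], OF assms(2)]
      have "\<not> (p dvd s n \<and> p dvd s (Suc n))"
      proof
        assume a: "p dvd s n \<and> p dvd s (Suc n)"
        have "(t n)\<^sup>2 = 3 * (s (Suc n) * s m) - 2 * (s n)\<^sup>2" using i(1) by simp
        then have "p dvd (t n)\<^sup>2" using a sq[of "s n"] by simp
        then show False using a both sq by blast
      qed
      moreover have "\<not> (p dvd t n \<and> p dvd t (Suc n))"
      proof
        assume a: "p dvd t n \<and> p dvd t (Suc n)"
        have "(s n)\<^sup>2 = (t n)\<^sup>2 - 3 * (t (Suc n) * t m)" using i(3) by simp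
        then have "p dvd (s n)\<^sup>2" using a sq[of "t n"] by simp
        then show False using a both sq by blast
      qed
      moreover have "\<not> (p dvd s n \<and> p dvd t (Suc n))"
      proof
        assume a: "p dvd s n \<and> p dvd t (Suc n)"
        have "(t n)\<^sup>2 = 3 * (t (Suc n) * t m) + (s n)\<^sup>2" using i(3) by simp
        then have "p dvd (t n)\<^sup>2" using a sq[of "s n"] by simp
        then show False using a both sq by blast
      qed
      moreover have "p = 2" if a: "p dvd t n \<and> p dvd s (Suc n)"
      proof -
        have "2 * (s n)\<^sup>2 = 3 * (s (Suc n) * s m) - (t n)\<^sup>2" using i(1) by simp
        then have "p dvd 2 * (s n)\<^sup>2" using a sq[of "t n"] by simp
        then show ?thesis using a both sq two by blast
      qed
      ultimately show ?thesis using True Suc by auto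
    next
      case False
      note i = int_neighbours_even[OF False, unfolded Suc[symmetric], OF assms(2)]
      have "\<not> (p dvd s n \<and> p dvd s (Suc n))"
      proof
        assume a: "p dvd s n \<and> p dvd s (Suc n)"
        have "(t n)\<^sup>2 = s (Suc n) * s m - (s n)\<^sup>2" using i(1) by simp
        then have "p dvd (t n)\<^sup>2" using a sq[of "s n"] by simp
        then show False using a both sq by blast
      qed
      moreover have "\<not> (p dvd t n \<and> p dvd t (Suc n))"
      proof
        assume a: "p dvd t n \<and> p dvd t (Suc n)"
        have "(s n)\<^sup>2 = 2 * (t n)\<^sup>2 - t (Suc n) * t m" using i(3) by simp
        then have "p dvd (s n)\<^sup>2" using a sq[of "t n"] by simp
        then show False using a both sq by blast
      qed
      moreover have "\<not> (p dvd t n \<and> p dvd s (Suc n))"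
      proof
        assume a: "p dvd t n \<and> p dvd s (Suc n)"
        have "(s n)\<^sup>2 = s (Suc n) * s m - (t n)\<^sup>2" using i(1) by simp
        then have "p dvd (s n)\<^sup>2" using a sq[of "t n"] by simp
        then show False using a both sq by blast
      qed
      moreover have "p = 2" if a: "p dvd s n \<and> p dvd t (Suc n)"
      proof -
        have "2 * (t n)\<^sup>2 = t (Suc n) * t m + (s n)\<^sup>2" using i(3) by simp
        then have "p dvd 2 * (t n)\<^sup>2" using a sq[of "s n"] by simp
        then show ?thesis using a both sq two by blast
      qed
      ultimately show ?thesis using False Suc by auto
    qed
  qed
  then show "\<not> (p dvd s n \<and> p dvd s (Suc n))" "\<not> (p dvd t n \<and> p dvd t (Suc n))"
    "p dvd s n \<and> p dvd t (Suc n) \<Longrightarrow> even n \<and> p = 2"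
    "p dvd t n \<and> p dvd s (Suc n) \<Longrightarrow> odd n \<and> p = 2"
    by blast+
qed

lemma coprime_consecutive:
  assumes "Suc n \<le> N"
  shows "coprime (s n) (s (Suc n))" "coprime (t n) (t (Suc n))"
  using prime_not_dvd_consecutive(1,2)[OF _ assms] by (auto intro!: coprime_intI_prime)

text \<open>Modulo 2 the relations determine each pair from the two before it. The mixed relation is
  needed for the residues 0 and 3 of \<open>m\<close>, where \<open>t m\<close> or
  \<open>s m\<close> is even and its product relation says nothing about the new term.\<close>

lemma parity:
  assumes "n \<le> N"
  shows "(even (s n) \<longleftrightarrow> n mod 6 = 3) \<and> (even (t n) \<longleftrightarrow> n mod 6 = 0)"
  using assms
proof (induction n rule: less_induct)
  case (less n)
  consider "n = 0" | "n = 1" | m where "n = Suc (Suc m)" by (metis One_nat_def not0_implies_Suc)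
  then show ?case
  proof cases
    case 3
    have IH: "even (s m) \<longleftrightarrow> m mod 6 = 3" "even (t m) \<longleftrightarrow> m mod 6 = 0"
      "even (s (Suc m)) \<longleftrightarrow> Suc m mod 6 = 3" "even (t (Suc m)) \<longleftrightarrow> Suc m mod 6 = 0"
      using less.IH[of m] less.IH[of "Suc m"] less.prems 3 by auto
    have e: "even (s n * s m) \<longleftrightarrow> (even (s (Suc m)) \<longleftrightarrow> even (t (Suc m)))" 
        "even (t n * t m) \<longleftrightarrow> even (s (Suc m))"
        "even (t n * s m + t m * s n) \<longleftrightarrow> even (s (Suc m)) \<or> even (t (Suc m))" if "odd m"
      using arg_cong[where f = even, OF int_neighbours_even(1)[OF that]]
        arg_cong[where f = even, OF int_neighbours_even(2)[OF that]]
        arg_cong[where f = even, OF int_neighbours_even(3)[OF that]] less.prems 3 by auto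
    have o: "even (s n * s m) \<longleftrightarrow> even (t (Suc m))"
        "even (t n * t m) \<longleftrightarrow> (even (s (Suc m)) \<longleftrightarrow> even (t (Suc m)))"
        "even (t n * s m + t m * s n) \<longleftrightarrow> even (s (Suc m)) \<or> even (t (Suc m))" if "even m"
      using arg_cong[where f = even, OF int_neighbours_odd(1)[OF that]]
        arg_cong[where f = even, OF int_neighbours_odd(2)[OF that]]
        arg_cong[where f = even, OF int_neighbours_odd(3)[OF that]] less.prems 3 by auto
    have "m mod 6 = 0 \<or> m mod 6 = 1 \<or> m mod 6 = 2 \<or> m mod 6 = 3 \<or> m mod 6 = 4 \<or> m mod 6 = 5"
      by presburger
    then show ?thesis
    proof (elim disjE)
      assume a: "m mod 6 = 0"
      then have "even m" "Suc m mod 6 = 1" "n mod 6 = 2" unfolding 3 by presburger+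
      then show ?thesis using o IH a by auto
    next
      assume a: "m mod 6 = 1"
      then have "odd m" "Suc m mod 6 = 2" "n mod 6 = 3" unfolding 3 by presburger+
      then show ?thesis using e IH a by auto
    next
      assume a: "m mod 6 = 2"
      then have "even m" "Suc m mod 6 = 3" "n mod 6 = 4" unfolding 3 by presburger+
      then show ?thesis using o IH a by auto
    next
      assume a: "m mod 6 = 3"
      then have "odd m" "Suc m mod 6 = 4" "n mod 6 = 5" unfolding 3 by presburger+
      then show ?thesis using e IH a by auto
    next
      assume a: "m mod 6 = 4"
      then have "even m" "Suc m mod 6 = 5" "n mod 6 = 0" unfolding 3 by presburger+
      then show ?thesis using o IH a by auto
    next
      assume a: "m mod 6 = 5"
      then have "odd m" "Suc m mod 6 = 0" "n mod 6 = 1" unfolding 3 by presburger+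
      then show ?thesis using e IH a by auto
    qed
  qed (use int_values less.prems in auto)
qed

end

lemma Ints_of_coprime_multiples:
  fixes x :: real and a b :: int
  assumes "coprime a b" "x * of_int a \<in> \<int>" "x * of_int b \<in> \<int>"
  shows "x \<in> \<int>"
proof -
  obtain u v where "u * a + v * b = 1"
    using assms(1) bezout_int[of a b] by (auto simp: coprime_iff_gcd_eq_1)
  then have "x = x * of_int (u * a + v * b)" by simp
  also have "\<dots> = of_int u * (x * of_int a) + of_int v * (x * of_int b)"
    by (simp add: algebra_simps)
  also have "\<dots> \<in> \<int>" using assms(2,3) by simp
  finally show ?thesis .
qed

text \<open>
  The term with index \<open>m + 5\<close> times either of the coprime terms with indices \<open>m\<close> and \<open>m + 1\<close> is an integer.
\<close>

lemma seq_Ints: "sseq n \<in> \<int> \<and> tseq n \<in> \<int>"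
proof (induction n rule: less_induct)
  case (less n)
  show ?case
  proof (cases "n < 6")
    case True
    then have "n = 0 \<or> n = 1 \<or> n = 2 \<or> n = 3 \<or> n = 4 \<or> n = 5" by arith
    then show ?thesis using seq_values by auto
  next
    case False
    define m where "m = n - 5"
    have m: "n = m + 5" "0 < m" using False by (auto simp: m_def)
    interpret integral_prefix "\<lambda>k. \<lfloor>sseq k\<rfloor>" "\<lambda>k. \<lfloor>tseq k\<rfloor>" "n - 1"
      by unfold_locales (use less m in auto)
    have fl: "real_of_int \<lfloor>sseq k\<rfloor> = sseq k" "real_of_int \<lfloor>tseq k\<rfloor> = tseq k" if "k < n" for k
      using less[OF that] by auto
    have I: "sseq k \<in> \<int>" "tseq k \<in> \<int>" if "k < m + 5" for k
      using less that m by auto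
    have "sseq n * sseq m \<in> \<int>" "tseq n * tseq m \<in> \<int>"
      unfolding m(1) sseq_somos tseq_somos[OF m(2)] by (auto intro!: Ints_add Ints_mult I)
    moreover have "sseq n * sseq (Suc m) \<in> \<int> \<and> tseq n * tseq (Suc m) \<in> \<int>"
    proof (cases "even m")
      case True
      then show ?thesis
        using two_step_odd(1,2)[of "Suc m"] m I[of "Suc m + 2"]
        by (auto simp: add.commute intro!: Ints_add Ints_mult Ints_diff Ints_power)
    next
      case False
      then show ?thesis
        using two_step_even(1,2)[of "Suc m"] m I[of "Suc m + 2"]
        by (auto simp: add.commute intro!: Ints_add Ints_mult Ints_diff Ints_power)
    qed
    moreover have "m < n" "Suc m < n" using m by auto
    ultimately show ?thesis
      using Ints_of_coprime_multiples[OF coprime_consecutive(1)[of m], of "sseq n"]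
        Ints_of_coprime_multiples[OF coprime_consecutive(2)[of m], of "tseq n"] m
      by (simp add: fl)
  qed
qed

context integral_prefix
begin

text \<open>The exceptional prime 2 is ruled out by \<open>parity\<close>: even terms of
  \<open>s\<close> have odd index, even terms of \<open>t\<close> have even index.\<close>

lemma prime_not_dvd_neighbours:
  assumes p: "prime p" and "Suc n \<le> N"
  shows "\<not> (p dvd s n \<and> p dvd t (Suc n))" "\<not> (p dvd t n \<and> p dvd s (Suc n))"
proof -
  have q: "even (s n) \<longleftrightarrow> n mod 6 = 3" "even (t n) \<longleftrightarrow> n mod 6 = 0"
    using parity[of n] assms(2) by auto
  show "\<not> (p dvd s n \<and> p dvd t (Suc n))"
  proof
    assume a: "p dvd s n \<and> p dvd t (Suc n)"
    then have "even n" "p = 2" using prime_not_dvd_consecutive(3)[OF assms] by auto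
    then have "even n" "n mod 6 = 3" using a q by auto
    then show False by presburger
  qed
  show "\<not> (p dvd t n \<and> p dvd s (Suc n))"
  proof
    assume a: "p dvd t n \<and> p dvd s (Suc n)"
    then have "odd n" "p = 2" using prime_not_dvd_consecutive(4)[OF assms] by auto
    then have "odd n" "n mod 6 = 0" using a q by auto
    then show False by presburger
  qed
qed

text \<open>(c, d) is (2, 1) for even \<open>n\<close> and (1, 2) for odd \<open>n\<close>; the
  divisibility argument below only uses that a prime factor of either is 2.\<close>

lemma int_two_step:
  assumes "n + 4 \<le> N"
  obtains c d where "c = 1 \<or> c = 2" "d = 1 \<or> d = 2"
    and "s (n + 4) * s n = (s (n + 2))\<^sup>2 + c * (t (n + 2))\<^sup>2"
    and "t (n + 4) * t n = (t (n + 2))\<^sup>2 - d * (s (n + 2))\<^sup>2"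
proof (cases "even n")
  case True
  have "real_of_int (s (n + 4) * s n) = of_int ((s (n + 2))\<^sup>2 + 2 * (t (n + 2))\<^sup>2)"
    "real_of_int (t (n + 4) * t n) = of_int ((t (n + 2))\<^sup>2 - 1 * (s (n + 2))\<^sup>2)"
    using two_step_even(1,2)[OF True] assms by (simp_all add: sseq_of_int tseq_of_int)
  then show ?thesis using that[of 2 1] by (simp only: of_int_eq_iff) simp
next
  case False
  have "real_of_int (s (n + 4) * s n) = of_int ((s (n + 2))\<^sup>2 + 1 * (t (n + 2))\<^sup>2)"
    "real_of_int (t (n + 4) * t n) = of_int ((t (n + 2))\<^sup>2 - 2 * (s (n + 2))\<^sup>2)"
    using two_step_odd(1,2)[OF False] assms by (simp_all add: sseq_of_int tseq_of_int)
  then show ?thesis using that[of 1 2] by (simp only: of_int_eq_iff) simp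
qed

text \<open>As for neighbours, the coefficients leave only p = 2, and \<open>parity\<close> puts
  even terms of one sequence six indices apart.\<close>

lemma prime_not_dvd_two_apart:
  assumes p: "prime p" and N: "n + 4 \<le> N"
  shows "\<not> (p dvd s (n + 2) \<and> p dvd s n)" "\<not> (p dvd s (n + 2) \<and> p dvd t (n + 4))"
    and "\<not> (p dvd t (n + 2) \<and> p dvd s n)" "\<not> (p dvd t (n + 2) \<and> p dvd t (n + 4))"
proof -
  obtain c d where cd: "c = 1 \<or> c = 2" "d = 1 \<or> d = 2"
    and i: "s (n + 4) * s n = (s (n + 2))\<^sup>2 + c * (t (n + 2))\<^sup>2"
      "t (n + 4) * t n = (t (n + 2))\<^sup>2 - d * (s (n + 2))\<^sup>2"
    using int_two_step[OF N] .
  have both: "p dvd s (n + 2) \<Longrightarrow> \<not> p dvd t (n + 2)" using prime_not_dvd_both[OF p, of "n + 2"] N by simp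
  have sq: "p dvd x\<^sup>2 \<longleftrightarrow> p dvd x" for x :: int
    using p by (simp add: prime_dvd_power_iff)
  have two: "p dvd x \<or> p = 2" if "p dvd c * x \<or> p dvd d * x" for x :: int
    using that cd p primes_dvd_imp_eq[of p 2] by (auto simp: prime_dvd_mult_iff)
  have par: "\<not> (even (s (n + 2)) \<and> even (s n))" "\<not> (even (t (n + 2)) \<and> even (t (n + 4)))"
  proof -
    have "\<not> ((n + 2) mod 6 = 3 \<and> n mod 6 = 3)" "\<not> ((n + 2) mod 6 = 0 \<and> (n + 4) mod 6 = 0)"
      by presburger+
    then show "\<not> (even (s (n + 2)) \<and> even (s n))" "\<not> (even (t (n + 2)) \<and> even (t (n + 4)))"
      using parity[of n] parity[of "n + 2"] parity[of "n + 4"] N by simp_all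
  qed
  show "\<not> (p dvd s (n + 2) \<and> p dvd s n)"
  proof
    assume a: "p dvd s (n + 2) \<and> p dvd s n"
    have "c * (t (n + 2))\<^sup>2 = s (n + 4) * s n - (s (n + 2))\<^sup>2" using i(1) by simp
    then have "p dvd c * (t (n + 2))\<^sup>2" using a sq[of "s (n + 2)"] by simp
    then show False using a both sq two par(1) by blast
  qed
  show "\<not> (p dvd s (n + 2) \<and> p dvd t (n + 4))"
  proof
    assume a: "p dvd s (n + 2) \<and> p dvd t (n + 4)"
    have "(t (n + 2))\<^sup>2 = t (n + 4) * t n + d * (s (n + 2))\<^sup>2" using i(2) by simp
    then have "p dvd (t (n + 2))\<^sup>2" using a sq[of "s (n + 2)"] by simp
    then show False using a both sq by blast
  qed
  show "\<not> (p dvd t (n + 2) \<and> p dvd s n)"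
  proof
    assume a: "p dvd t (n + 2) \<and> p dvd s n"
    have "(s (n + 2))\<^sup>2 = s (n + 4) * s n - c * (t (n + 2))\<^sup>2" using i(1) by simp
    then have "p dvd (s (n + 2))\<^sup>2" using a sq[of "t (n + 2)"] by simp
    then show False using a both sq by blast
  qed
  show "\<not> (p dvd t (n + 2) \<and> p dvd t (n + 4))"
  proof
    assume a: "p dvd t (n + 2) \<and> p dvd t (n + 4)"
    have "d * (s (n + 2))\<^sup>2 = (t (n + 2))\<^sup>2 - t (n + 4) * t n" using i(2) by simp
    then have "p dvd d * (s (n + 2))\<^sup>2" using a sq[of "t (n + 2)"] by simp
    then show False using a both sq two par(2) by blast
  qed
qed

section \<open>Common prime divisors of the four terms and of the sides\<close>

definition term_x :: "nat \<Rightarrow> int" where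
  "term_x n = s (n + 1) * s (n + 2) ^ 3 * s (n + 3) * t (n + 2)"

definition term_y :: "nat \<Rightarrow> int" where
  "term_y n = s n ^ 2 * s (n + 1) * t (n + 3) * t (n + 4) ^ 2"

definition term_z :: "nat \<Rightarrow> int" where
  "term_z n = t (n + 1) * t (n + 2) ^ 3 * t (n + 3) * s (n + 2)"

text \<open>The mirror image of \<open>term_y\<close> under n + i -> n + 4 - i;
  \<open>term_x\<close> and \<open>term_z\<close> are their own mirror images.\<close>

definition term_w :: "nat \<Rightarrow> int" where
  "term_w n = s (n + 3) * s (n + 4) ^ 2 * t n ^ 2 * t (n + 1)"

text \<open>Once the prime is pushed into the factors the problem is propositional: every choice of
  one factor from each term contains a pair at index distance at most two that is already
  excluded.\<close>

lemma no_common_prime_terms: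
  assumes p: "prime p" and N: "n + 4 \<le> N"
    and d: "p dvd term_x n" "p dvd term_y n" "p dvd term_z n" "p dvd term_w n"
  shows False
proof -
  have pow: "p dvd x ^ 2 \<longleftrightarrow> p dvd x" "p dvd x ^ 3 \<longleftrightarrow> p dvd x" for x :: int
    using p by (simp_all add: prime_dvd_power_iff)
  note dvd = d[unfolded term_x_def term_y_def term_z_def term_w_def prime_dvd_mult_iff[OF p] pow]
  note two = prime_not_dvd_two_apart[OF p N]
  have nb: "\<not> (p dvd s k \<and> p dvd t k)" "\<not> (p dvd s k \<and> p dvd s (k + 1))" "\<not> (p dvd t k \<and> p dvd t (k + 1))"
    "\<not> (p dvd s k \<and> p dvd t (k + 1))" "\<not> (p dvd t k \<and> p dvd s (k + 1))" if "k < n + 4" for k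
    using prime_not_dvd_both[OF p, of k] prime_not_dvd_consecutive(1,2)[OF p, of k]
      prime_not_dvd_neighbours[OF p, of k] that N by auto
  have 0: "n + 1 + 1 = n + 2" "n + 2 + 1 = n + 3" "n + 3 + 1 = n + 4" "n < n + 4" "n + 1 < n + 4" "n + 2 < n + 4" "n + 3 < n + 4"
    by simp_all
  note n0 = nb[OF 0(4)] and n1 = nb[OF 0(5), unfolded 0] and n2 = nb[OF 0(6), unfolded 0] and n3 = nb[OF 0(7), unfolded 0]
  show False using dvd two n0 n1 n2 n3 by argo
qed

text \<open>Among n, ..., n + 4 some index is 3 modulo 6 unless n mod 6 = 4, and then
  \<open>t (n + 2)\<close> is even.\<close>

lemma some_term_even:
  assumes "n + 4 \<le> N"
  shows "even (term_x n) \<or> even (term_y n) \<or> even (term_w n)"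
proof -
  have e: "even (s k) \<longleftrightarrow> k mod 6 = 3" "even (t k) \<longleftrightarrow> k mod 6 = 0" if "k \<le> n + 4" for k
    using parity[of k] that assms by auto
  have r: "(n + i) mod 6 = (n mod 6 + i) mod 6" for i
    by (simp add: mod_add_left_eq)
  have "n mod 6 < 6" by simp
  then have "n mod 6 = 0 \<or> n mod 6 = 1 \<or> n mod 6 = 2 \<or> n mod 6 = 3 \<or> n mod 6 = 4 \<or> n mod 6 = 5"
    by arith
  then have "(n + 1) mod 6 = 3 \<or> (n + 2) mod 6 = 3 \<or> (n + 3) mod 6 = 3 \<or> (n + 2) mod 6 = 0 \<or> n mod 6 = 3 \<or> (n + 4) mod 6 = 3"
    unfolding r by (elim disjE) simp_all
  then show ?thesis
    unfolding term_x_def term_y_def term_w_def by (auto simp: e)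
qed

text \<open>An odd prime dividing the signed sides divides 2 x, 2 y, 2 z, hence all four terms. For
  p = 2 the four terms have equal parity, \<open>w\<close> by \<open>sum\<close>, and one of them is
  even.\<close>

lemma no_common_prime_sides:
  assumes p: "prime p" and N: "n + 4 \<le> N" and sum: "term_z n = term_x n + term_y n + term_w n"
    and d: "p dvd term_x n + term_y n" "p dvd term_y n - term_z n" "p dvd term_z n - term_x n"
  shows False
proof (cases "p = 2")
  case True
  then show False
    using some_term_even[OF N] d sum no_common_prime_terms[OF p N] by auto
next
  case False
  have two: "p dvd 2 * x \<longleftrightarrow> p dvd x" for x :: int
    using p False primes_dvd_imp_eq[of p 2] by (auto simp: prime_dvd_mult_iff)
  have e: "2 * term_x n = (term_x n + term_y n) - ((term_y n - term_z n) + (term_z n - term_x n))"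
    "2 * term_y n = (term_x n + term_y n) + ((term_y n - term_z n) + (term_z n - term_x n))"
    "2 * term_z n = (term_x n + term_y n) - (term_y n - term_z n) + (term_z n - term_x n)"
    "term_w n = term_z n - (term_x n + term_y n)"
    using sum by simp_all
  have "p dvd 2 * term_x n" "p dvd 2 * term_y n" "p dvd 2 * term_z n"
    unfolding e(1-3) by (intro dvd_add dvd_diff d)+
  then have xyz: "p dvd term_x n" "p dvd term_y n" "p dvd term_z n"
    unfolding two .
  then have "p dvd term_w n"
    unfolding e(4) using d(1) by (intro dvd_diff)
  then show False using no_common_prime_terms[OF p N] xyz by blast
qed

end

lemma integral_prefix_floor: "integral_prefix (\<lambda>k. \<lfloor>sseq k\<rfloor>) (\<lambda>k. \<lfloor>tseq k\<rfloor>) N"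
  by unfold_locales (use seq_Ints in auto)

section \<open>Area and medians\<close>

text \<open>
  With \<open>P = B C\<close> and \<open>Q = D A\<close> everything reduces to the quadratic extension generated by \<open>P\<close> over the
  rational functions in \<open>S, T\<close>, since \<open>P + Q\<close> and \<open>P Q\<close> are forms in \<open>S, T\<close>.
\<close>

lemma heron_terms_even:
  fixes S T A B C D S2 T2 R2 Q2 :: real
  assumes mid: "A * C = S\<^sup>2 + T\<^sup>2" "B * C + D * A = - 3 * (S * T)" "B * D = 2 * T\<^sup>2 - S\<^sup>2"
    and two: "R2 * T2 = D * A + S * T" "Q2 * S2 = B * C + S * T"
  shows "D * T ^ 3 * B * S = C * S ^ 3 * A * T + R2\<^sup>2 * C * B * T2\<^sup>2 + A * S2\<^sup>2 * Q2\<^sup>2 * D"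
proof -
  define P Q where "P = B * C" and "Q = D * A"
  have PQ: "P + Q = - 3 * (S * T)" "P * Q = (S\<^sup>2 + T\<^sup>2) * (2 * T\<^sup>2 - S\<^sup>2)"
    using mid by (simp add: P_def Q_def) (use mid P_def Q_def in algebra)
  have "R2\<^sup>2 * C * B * T2\<^sup>2 + A * S2\<^sup>2 * Q2\<^sup>2 * D = (R2 * T2)\<^sup>2 * P + (Q2 * S2)\<^sup>2 * Q"
    unfolding P_def Q_def by algebra
  also have "\<dots> = (Q + S * T)\<^sup>2 * P + (P + S * T)\<^sup>2 * Q"
    unfolding two P_def Q_def ..
  \<comment> \<open>Symmetric in \<open>P\<close> and \<open>Q\<close>, so their sum and product
    suffice.\<close>
  also have "\<dots> = S * T * (2 * T ^ 4 - 2 * S\<^sup>2 * T\<^sup>2 - S ^ 4)"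
    using PQ by algebra
  also have "\<dots> = T ^ 3 * S * (B * D) - S ^ 3 * T * (A * C)"
    unfolding mid by algebra
  finally show ?thesis by algebra
qed

lemma heron_terms_odd:
  fixes S T A B C D S2 T2 R2 Q2 :: real
  assumes mid: "3 * (A * C) = 2 * S\<^sup>2 + T\<^sup>2" "B * C + D * A = - (S * T)" "3 * (B * D) = T\<^sup>2 - S\<^sup>2"
    and two: "R2 * T2 = 3 * (D * A) + S * T" "Q2 * S2 = 3 * (B * C) + S * T"
  shows "D * T ^ 3 * B * S = C * S ^ 3 * A * T + R2\<^sup>2 * C * B * T2\<^sup>2 + A * S2\<^sup>2 * Q2\<^sup>2 * D"
proof -
  define P Q where "P = B * C" and "Q = D * A"
  have PQ: "P + Q = - (S * T)" "9 * (P * Q) = (2 * S\<^sup>2 + T\<^sup>2) * (T\<^sup>2 - S\<^sup>2)"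
    using mid by (simp add: P_def Q_def) (use mid P_def Q_def in algebra)
  have "3 * (R2\<^sup>2 * C * B * T2\<^sup>2 + A * S2\<^sup>2 * Q2\<^sup>2 * D) = 3 * ((R2 * T2)\<^sup>2 * P + (Q2 * S2)\<^sup>2 * Q)"
    unfolding P_def Q_def by algebra
  also have "\<dots> = 3 * ((3 * Q + S * T)\<^sup>2 * P + (3 * P + S * T)\<^sup>2 * Q)"
    unfolding two P_def Q_def ..
  also have "\<dots> = S * T * (T ^ 4 - 2 * S\<^sup>2 * T\<^sup>2 - 2 * S ^ 4)"
    using PQ by algebra
  also have "\<dots> = T ^ 3 * S * (3 * (B * D)) - S ^ 3 * T * (3 * (A * C))"
    unfolding mid by algebra
  finally show ?thesis by algebra
qed

text \<open>The squared expression is, up to sign, twice the median. The window is abstract so that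
  reading it backwards, which exchanges \<open>y\<close> and \<open>w\<close>, also yields the
  second median.\<close>

lemma median_even:
  fixes S T A B C D S2 T2 R2 Q2 :: real
  assumes mid: "A * C = S\<^sup>2 + T\<^sup>2" "B * C + D * A = - 3 * (S * T)" "B * D = 2 * T\<^sup>2 - S\<^sup>2"
    and out: "3 * (S2 * S) = 2 * A\<^sup>2 + B\<^sup>2" "3 * (T2 * T) = B\<^sup>2 - A\<^sup>2"
    and two: "S2 * R2 = S\<^sup>2 + 2 * T\<^sup>2" "T2 * Q2 = T\<^sup>2 - S\<^sup>2" "R2 * T2 = D * A + S * T"
    and nz: "S \<noteq> 0" "T \<noteq> 0"
    and x: "x = C * S ^ 3 * A * T" and y: "y = R2\<^sup>2 * C * B * T2\<^sup>2" and z: "z = D * T ^ 3 * B * S"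
  shows "(S2 * T2 * (Q2 * D\<^sup>2 * T - R2 * C\<^sup>2 * S))\<^sup>2 = 2 * (y - z)\<^sup>2 + 2 * (z - x)\<^sup>2 - (x + y)\<^sup>2"
proof -
  define P Q where "P = B * C" and "Q = D * A"
  have PQ: "Q = - 3 * (S * T) - P" "P * Q = (S\<^sup>2 + T\<^sup>2) * (2 * T\<^sup>2 - S\<^sup>2)"
    using mid by (simp add: P_def Q_def) (use mid P_def Q_def in algebra)
  define K where "K = S2 * T2 * (Q2 * D\<^sup>2 * T - R2 * C\<^sup>2 * S)"
  \<comment> \<open>The factor 3 S T makes \<open>out\<close> applicable and leads to an expression
    for \<open>K\<close> that is linear in \<open>P\<close>.\<close>
  have "3 * (S * T) * K = (T2 * Q2) * T\<^sup>2 * (3 * (S2 * S) * D\<^sup>2) - (S2 * R2) * S\<^sup>2 * (3 * (T2 * T) * C\<^sup>2)"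
    unfolding K_def by algebra
  also have "\<dots> = (T\<^sup>2 - S\<^sup>2) * T\<^sup>2 * (2 * Q\<^sup>2 + (B * D)\<^sup>2) - (S\<^sup>2 + 2 * T\<^sup>2) * S\<^sup>2 * (P\<^sup>2 - (A * C)\<^sup>2)"
    unfolding two out P_def Q_def by algebra
  also have "\<dots> = 3 * (S * T) * (P * (2 * T ^ 4 + S ^ 4) + 6 * (S * T ^ 5))"
    unfolding mid using PQ by algebra
  finally have K: "K = P * (2 * T ^ 4 + S ^ 4) + 6 * (S * T ^ 5)"
    using nz by simp
  have "y = (R2 * T2)\<^sup>2 * P" unfolding y P_def by algebra
  also have "\<dots> = (Q + S * T)\<^sup>2 * P" unfolding two Q_def ..
  finally have y': "y = (Q + S * T)\<^sup>2 * P" .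
  have x': "x = S ^ 3 * T * (S\<^sup>2 + T\<^sup>2)" unfolding x mid(1)[symmetric] by algebra
  have z': "z = S * T ^ 3 * (2 * T\<^sup>2 - S\<^sup>2)" unfolding z mid(3)[symmetric] by algebra
  have y'': "y = (S\<^sup>2 * T\<^sup>2 - (S\<^sup>2 + T\<^sup>2) * (2 * T\<^sup>2 - S\<^sup>2)) * P - S * T * ((S\<^sup>2 + T\<^sup>2) * (2 * T\<^sup>2 - S\<^sup>2))"
    using y' PQ by algebra
  have PP: "P\<^sup>2 = - 3 * (S * T) * P - (S\<^sup>2 + T\<^sup>2) * (2 * T\<^sup>2 - S\<^sup>2)"
    using PQ by algebra
  show ?thesis
    unfolding K_def[symmetric] K x' z' y'' using PP by algebra
qed

lemma median_odd:
  fixes S T A B C D S2 T2 R2 Q2 :: real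
  assumes mid: "3 * (A * C) = 2 * S\<^sup>2 + T\<^sup>2" "B * C + D * A = - (S * T)" "3 * (B * D) = T\<^sup>2 - S\<^sup>2"
    and out: "S2 * S = A\<^sup>2 + B\<^sup>2" "T2 * T = 2 * B\<^sup>2 - A\<^sup>2"
    and two: "S2 * R2 = S\<^sup>2 + T\<^sup>2" "T2 * Q2 = T\<^sup>2 - 2 * S\<^sup>2" "R2 * T2 = 3 * (D * A) + S * T"
    and nz: "S \<noteq> 0" "T \<noteq> 0"
    and x: "x = C * S ^ 3 * A * T" and y: "y = R2\<^sup>2 * C * B * T2\<^sup>2" and z: "z = D * T ^ 3 * B * S"
  shows "(S2 * T2 * (Q2 * D\<^sup>2 * T - R2 * C\<^sup>2 * S))\<^sup>2 = 2 * (y - z)\<^sup>2 + 2 * (z - x)\<^sup>2 - (x + y)\<^sup>2"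
proof -
  define P Q where "P = B * C" and "Q = D * A"
  have PQ: "Q = - (S * T) - P" "9 * (P * Q) = (2 * S\<^sup>2 + T\<^sup>2) * (T\<^sup>2 - S\<^sup>2)"
    using mid by (simp add: P_def Q_def) (use mid P_def Q_def in algebra)
  define K where "K = S2 * T2 * (Q2 * D\<^sup>2 * T - R2 * C\<^sup>2 * S)"
  have "9 * (S * T) * K = (T2 * Q2) * T\<^sup>2 * (9 * (S2 * S) * D\<^sup>2) - (S2 * R2) * S\<^sup>2 * (9 * (T2 * T) * C\<^sup>2)"
    unfolding K_def by algebra
  also have "\<dots> = (T\<^sup>2 - 2 * S\<^sup>2) * T\<^sup>2 * (9 * Q\<^sup>2 + (3 * (B * D))\<^sup>2) - (S\<^sup>2 + T\<^sup>2) * S\<^sup>2 * (18 * P\<^sup>2 - (3 * (A * C))\<^sup>2)"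
    unfolding two out P_def Q_def by algebra
  also have "\<dots> = 9 * (S * T) * (P * (T ^ 4 + 2 * S ^ 4) + S * T ^ 5)"
    unfolding mid using PQ by algebra
  finally have K: "K = P * (T ^ 4 + 2 * S ^ 4) + S * T ^ 5"
    using nz by simp
  have "y = (R2 * T2)\<^sup>2 * P" unfolding y P_def by algebra
  also have "\<dots> = (3 * Q + S * T)\<^sup>2 * P" unfolding two Q_def ..
  finally have y': "y = (3 * Q + S * T)\<^sup>2 * P" .
  have x': "3 * x = S ^ 3 * T * (2 * S\<^sup>2 + T\<^sup>2)" unfolding x mid(1)[symmetric] by algebra
  have z': "3 * z = S * T ^ 3 * (T\<^sup>2 - S\<^sup>2)" unfolding z mid(3)[symmetric] by algebra
  have y'': "3 * y = 3 * (S\<^sup>2 * T\<^sup>2 - (2 * S\<^sup>2 + T\<^sup>2) * (T\<^sup>2 - S\<^sup>2)) * P - S * T * ((2 * S\<^sup>2 + T\<^sup>2) * (T\<^sup>2 - S\<^sup>2))"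
    using y' PQ by algebra
  have PP: "9 * P\<^sup>2 = - 9 * (S * T) * P - (2 * S\<^sup>2 + T\<^sup>2) * (T\<^sup>2 - S\<^sup>2)"
    using PQ by algebra
  \<comment> \<open>Only 3 x, 3 y and 3 z are available as polynomials in S, T and P, hence the
    factor 9.\<close>
  have "9 * K\<^sup>2 = 2 * (3 * y - 3 * z)\<^sup>2 + 2 * (3 * z - 3 * x)\<^sup>2 - (3 * x + 3 * y)\<^sup>2"
    unfolding K x' z' y'' using PP by algebra
  then show ?thesis
    unfolding K_def by algebra
qed

lemma seq_heron_median_identities:
  fixes n :: nat
  defines "x \<equiv> sseq (n + 1) * sseq (n + 2) ^ 3 * sseq (n + 3) * tseq (n + 2)"
    and "y \<equiv> sseq n ^ 2 * sseq (n + 1) * tseq (n + 3) * tseq (n + 4) ^ 2"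
    and "z \<equiv> tseq (n + 1) * tseq (n + 2) ^ 3 * tseq (n + 3) * sseq (n + 2)"
    and "w \<equiv> sseq (n + 3) * sseq (n + 4) ^ 2 * tseq n ^ 2 * tseq (n + 1)"
  shows "z = x + y + w"
    and "(sseq (n + 4) * tseq (n + 4) * (tseq n * tseq (n + 1) ^ 2 * tseq (n + 2) - sseq n * sseq (n + 1) ^ 2 * sseq (n + 2)))\<^sup>2
      = 2 * (y - z)\<^sup>2 + 2 * (z - x)\<^sup>2 - (x + y)\<^sup>2"
    and "(sseq n * tseq n * (tseq (n + 2) * tseq (n + 3) ^ 2 * tseq (n + 4) - sseq (n + 2) * sseq (n + 3) ^ 2 * sseq (n + 4)))\<^sup>2
      = 2 * (z - x)\<^sup>2 + 2 * (x + y)\<^sup>2 - (y - z)\<^sup>2"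
proof -
  define S T A B C D S2 T2 R2 Q2 where "S = sseq (n + 2)" and "T = tseq (n + 2)"
    and "A = sseq (n + 3)" and "B = tseq (n + 3)" and "C = sseq (n + 1)" and "D = tseq (n + 1)"
    and "S2 = sseq (n + 4)" and "T2 = tseq (n + 4)" and "R2 = sseq n" and "Q2 = tseq n"
  note defs = S_def T_def A_def B_def C_def D_def S2_def T2_def R2_def Q2_def
  have nz: "S \<noteq> 0" "T \<noteq> 0"
    by (simp_all add: S_def T_def tseq_nonzero)
  have x: "x = C * S ^ 3 * A * T" "x = A * S ^ 3 * C * T" and y: "y = R2\<^sup>2 * C * B * T2\<^sup>2"
    and z: "z = D * T ^ 3 * B * S" "z = B * T ^ 3 * D * S" and w: "w = A * S2\<^sup>2 * Q2\<^sup>2 * D" "w = S2\<^sup>2 * A * D * Q2\<^sup>2"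
    by (simp_all add: x_def y_def z_def w_def defs)
  have "z = x + y + w \<and>
      (S2 * T2 * (Q2 * D\<^sup>2 * T - R2 * C\<^sup>2 * S))\<^sup>2 = 2 * (y - z)\<^sup>2 + 2 * (z - x)\<^sup>2 - (x + y)\<^sup>2 \<and>
      (R2 * Q2 * (T2 * B\<^sup>2 * T - S2 * A\<^sup>2 * S))\<^sup>2 = 2 * (w - z)\<^sup>2 + 2 * (z - x)\<^sup>2 - (x + w)\<^sup>2"
  proof (cases "even n")
    case True
    have mid: "A * C = S\<^sup>2 + T\<^sup>2" "B * C + D * A = - 3 * (S * T)" "B * D = 2 * T\<^sup>2 - S\<^sup>2"
      using neighbours_even[of "Suc n"] True by (simp_all add: defs add_numeral_Suc)
    have right: "3 * (S2 * S) = 2 * A\<^sup>2 + B\<^sup>2" "3 * (T2 * T) = B\<^sup>2 - A\<^sup>2"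
      using neighbours_odd[of "Suc (Suc n)"] True by (simp_all add: defs add_numeral_Suc)
    have left: "3 * (R2 * S) = 2 * C\<^sup>2 + D\<^sup>2" "3 * (Q2 * T) = D\<^sup>2 - C\<^sup>2"
      using neighbours_odd[of n] True by (simp_all add: defs add_numeral_Suc mult.commute)
    have two: "S2 * R2 = S\<^sup>2 + 2 * T\<^sup>2" "T2 * Q2 = T\<^sup>2 - S\<^sup>2" "R2 * T2 = D * A + S * T" "Q2 * S2 = B * C + S * T"
      using two_step_even[OF True] by (simp_all add: defs)
    \<comment> \<open>The window read from right to left; together with \<open>left\<close> it
      supplies the median lemma with \<open>w\<close> in place of \<open>y\<close>.\<close>
    have swapped: "C * A = S\<^sup>2 + T\<^sup>2" "D * A + B * C = - 3 * (S * T)" "D * B = 2 * T\<^sup>2 - S\<^sup>2"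
      "R2 * S2 = S\<^sup>2 + 2 * T\<^sup>2" "Q2 * T2 = T\<^sup>2 - S\<^sup>2" "S2 * Q2 = B * C + S * T"
      using mid two by (simp_all add: mult.commute add.commute)
    show ?thesis
      using heron_terms_even[OF mid two(3,4)] median_even[OF mid right two(1-3) nz x(1) y z(1)]
        median_even[OF swapped(1-3) left swapped(4-6) nz x(2) w(2) z(2)]
      by (simp add: x(1) y z(1) w(1))
  next
    case False
    have mid: "3 * (A * C) = 2 * S\<^sup>2 + T\<^sup>2" "B * C + D * A = - (S * T)" "3 * (B * D) = T\<^sup>2 - S\<^sup>2"
      using neighbours_odd[of "Suc n"] False by (simp_all add: defs add_numeral_Suc)
    have right: "S2 * S = A\<^sup>2 + B\<^sup>2" "T2 * T = 2 * B\<^sup>2 - A\<^sup>2"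
      using neighbours_even[of "Suc (Suc n)"] False by (simp_all add: defs add_numeral_Suc)
    have left: "R2 * S = C\<^sup>2 + D\<^sup>2" "Q2 * T = 2 * D\<^sup>2 - C\<^sup>2"
      using neighbours_even[of n] False by (simp_all add: defs add_numeral_Suc mult.commute)
    have two: "S2 * R2 = S\<^sup>2 + T\<^sup>2" "T2 * Q2 = T\<^sup>2 - 2 * S\<^sup>2" "R2 * T2 = 3 * (D * A) + S * T"
      "Q2 * S2 = 3 * (B * C) + S * T"
      using two_step_odd[OF False] by (simp_all add: defs)
    have swapped: "3 * (C * A) = 2 * S\<^sup>2 + T\<^sup>2" "D * A + B * C = - (S * T)" "3 * (D * B) = T\<^sup>2 - S\<^sup>2"
      "R2 * S2 = S\<^sup>2 + T\<^sup>2" "Q2 * T2 = T\<^sup>2 - 2 * S\<^sup>2" "S2 * Q2 = 3 * (B * C) + S * T"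
      using mid two by (simp_all add: mult.commute add.commute)
    show ?thesis
      using heron_terms_odd[OF mid two(3,4)] median_odd[OF mid right two(1-3) nz x(1) y z(1)]
        median_odd[OF swapped(1-3) left swapped(4-6) nz x(2) w(2) z(2)]
      by (simp add: x(1) y z(1) w(1))
  qed
  then have sum: "z = x + y + w"
    and k: "(S2 * T2 * (Q2 * D\<^sup>2 * T - R2 * C\<^sup>2 * S))\<^sup>2 = 2 * (y - z)\<^sup>2 + 2 * (z - x)\<^sup>2 - (x + y)\<^sup>2"
    and l: "(R2 * Q2 * (T2 * B\<^sup>2 * T - S2 * A\<^sup>2 * S))\<^sup>2 = 2 * (w - z)\<^sup>2 + 2 * (z - x)\<^sup>2 - (x + w)\<^sup>2"
    by blast+
  show "z = x + y + w" by (rule sum)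
  show "(sseq (n + 4) * tseq (n + 4) * (tseq n * tseq (n + 1) ^ 2 * tseq (n + 2) - sseq n * sseq (n + 1) ^ 2 * sseq (n + 2)))\<^sup>2
      = 2 * (y - z)\<^sup>2 + 2 * (z - x)\<^sup>2 - (x + y)\<^sup>2"
    using k by (simp add: defs)
  have "R2 * Q2 * (T * B\<^sup>2 * T2 - S * A\<^sup>2 * S2) = R2 * Q2 * (T2 * B\<^sup>2 * T - S2 * A\<^sup>2 * S)"
    by simp
  \<comment> \<open>By \<open>sum\<close>, w - z = - (x + y) and x + w = z - y: reflection exchanges
    the first two sides up to sign.\<close>
  moreover have "2 * (w - z)\<^sup>2 + 2 * (z - x)\<^sup>2 - (x + w)\<^sup>2 = 2 * (z - x)\<^sup>2 + 2 * (x + y)\<^sup>2 - (y - z)\<^sup>2"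
    unfolding sum by algebra
  ultimately show "(sseq n * tseq n * (tseq (n + 2) * tseq (n + 3) ^ 2 * tseq (n + 4) - sseq (n + 2) * sseq (n + 3) ^ 2 * sseq (n + 4)))\<^sup>2
      = 2 * (z - x)\<^sup>2 + 2 * (x + y)\<^sup>2 - (y - z)\<^sup>2"
    using l unfolding defs[symmetric] by metis
qed

section \<open>Euclidean triangles with prescribed sides\<close>

lemma triangle_inequality_of_heron_pos:
  fixes a b c :: real
  assumes "0 \<le> a" "0 \<le> b" "0 \<le> c"
    and "0 < (a + b + c) * (- a + b + c) * (a - b + c) * (a + b - c)"
  shows "c < a + b"
proof (rule ccontr)
  assume "\<not> c < a + b"
  then have "0 \<le> (a + b + c) * (- a + b + c) * (a - b + c)" "a + b - c \<le> 0"
    using assms by auto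
  then show False using assms(4) mult_nonneg_nonpos by (meson not_less)
qed

lemma heron_strict_triangle:
  fixes a b c :: real
  assumes "0 \<le> a" "0 \<le> b" "0 \<le> c"
    and "0 < (a + b + c) * (- a + b + c) * (a - b + c) * (a + b - c)"
  shows "c < a + b" "a < b + c" "b < c + a"
  using triangle_inequality_of_heron_pos[of a b c] triangle_inequality_of_heron_pos[of b c a]
    triangle_inequality_of_heron_pos[of c a b] assms by (simp_all add: algebra_simps)

text \<open>\<open>A\<close> is put at the origin and \<open>B\<close> on the first axis; the law of
  cosines gives e = 2 b c cos A, and \<open>h\<close> is four times the area, so h / (2 c) is the
  height over \<open>A B\<close>.\<close>

lemma triangle_with_sides_exists:
  fixes a b c :: real
  assumes "0 \<le> a" "0 \<le> b" "0 \<le> c"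
    and pos: "0 < (a + b + c) * (- a + b + c) * (a - b + c) * (a + b - c)"
  shows "\<exists>A B C. triangle_with_sides A B C a b c"
proof -
  note tri = heron_strict_triangle[OF assms]
  have c: "0 < c" using tri by linarith
  define h where "h = sqrt ((a + b + c) * (- a + b + c) * (a - b + c) * (a + b - c))"
  have h: "h\<^sup>2 = (a + b + c) * (- a + b + c) * (a - b + c) * (a + b - c)"
    using pos by (simp add: h_def)
  define e where "e = b\<^sup>2 + c\<^sup>2 - a\<^sup>2"
  have dist: "dist X Y = sqrt ((X $ 1 - Y $ 1)\<^sup>2 + (X $ 2 - Y $ 2)\<^sup>2)" for X Y :: "real^2"
    by (simp add: dist_vec_def L2_set_def UNIV_2 dist_real_def)
  define A B C :: "real^2" where "A = vector [0, 0]" and "B = vector [c, 0]"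
    and "C = vector [e / (2 * c), h / (2 * c)]"
  have sq: "e\<^sup>2 + h\<^sup>2 = (2 * c)\<^sup>2 * b\<^sup>2" "(2 * c\<^sup>2 - e)\<^sup>2 + h\<^sup>2 = (2 * c)\<^sup>2 * a\<^sup>2"
    unfolding h e_def by algebra+
  have "dist B C = sqrt (((2 * c\<^sup>2 - e)\<^sup>2 + h\<^sup>2) / (2 * c)\<^sup>2)"
    unfolding dist B_def C_def using c by (simp add: power2_eq_square field_simps)
  also have "\<dots> = a" unfolding sq using c assms(1) by simp
  finally have BC: "dist B C = a" .
  have "dist C A = sqrt ((e\<^sup>2 + h\<^sup>2) / (2 * c)\<^sup>2)"
    unfolding dist A_def C_def using c by (simp add: power2_eq_square field_simps)
  also have "\<dots> = b" unfolding sq using c assms(2) by simp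
  finally have CA: "dist C A = b" .
  have AB: "dist A B = c"
    unfolding dist A_def B_def using c by simp
  \<comment> \<open>Three collinear points have one between the others, which is equality in a
    triangle inequality.\<close>
  have "\<not> collinear {A, B, C}"
    using tri BC CA AB unfolding collinear_between_cases between by (auto simp: dist_commute)
  then show ?thesis using BC CA AB unfolding triangle_with_sides_def by blast
qed

text \<open>Apollonius' theorem, from the parallelogram law for A - B and A - C.\<close>

lemma dist_midpoint_squared:
  fixes A B C :: "'a :: real_inner"
  shows "(dist A (midpoint B C))\<^sup>2 = 1/4 * (2 * (dist C A)\<^sup>2 + 2 * (dist A B)\<^sup>2 - (dist B C)\<^sup>2)"
proof -
  have "A - midpoint B C = (1/2) *\<^sub>R ((A - B) + (A - C))"
    by (simp add: midpoint_def algebra_simps flip: scaleR_add_left)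
  then have "4 * (dist A (midpoint B C))\<^sup>2 = (norm ((A - B) + (A - C)))\<^sup>2"
    by (simp add: dist_norm power_mult_distrib power_divide)
  also have "\<dots> = 2 * (norm (A - C))\<^sup>2 + 2 * (norm (A - B))\<^sup>2 - (norm (B - C))\<^sup>2"
    by (simp add: power2_norm_eq_inner inner_simps inner_commute)
  finally show ?thesis by (simp add: dist_norm norm_minus_commute)
qed

lemma triangle_with_sides_measures:
  assumes tri: "triangle_with_sides A B C a b c"
    and "0 \<le> k" "k\<^sup>2 = 1/4 * (2 * b\<^sup>2 + 2 * c\<^sup>2 - a\<^sup>2)"
    and "0 \<le> l" "l\<^sup>2 = 1/4 * (2 * c\<^sup>2 + 2 * a\<^sup>2 - b\<^sup>2)"
    and "0 \<le> \<Delta>" "s = (a + b + c) / 2" "\<Delta>\<^sup>2 = s * (s - a) * (s - b) * (s - c)"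
  shows "dist A (midpoint B C) = k" "dist B (midpoint C A) = l" "triangle_area A B C = \<Delta>"
proof -
  have d: "dist B C = a" "dist C A = b" "dist A B = c"
    using tri by (auto simp: triangle_with_sides_def)
  have "(dist A (midpoint B C))\<^sup>2 = k\<^sup>2" "(dist B (midpoint C A))\<^sup>2 = l\<^sup>2"
    unfolding dist_midpoint_squared d assms(3,5) by simp_all
  then show "dist A (midpoint B C) = k" "dist B (midpoint C A) = l"
    using assms(2,4) by (simp_all add: power2_eq_iff_nonneg)
  \<comment> \<open>Compactness makes the hull a Borel set, so its Lebesgue measure agrees with the
    \<open>lborel\<close> measure to which \<open>heron\<close> applies.\<close>
  have "compact (convex hull {A, B, C})"
    by (intro finite_imp_compact_convex_hull) simp
  then have "convex hull {A, B, C} \<in> sets lborel"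
    by (simp add: borel_compact)
  then have "triangle_area A B C = measure lborel (convex hull {A, B, C})"
    unfolding triangle_area_def by (rule measure_completion)
  also have "\<dots> = sqrt (s * (s - a) * (s - b) * (s - c))"
    using heron[of A B C] d(1,3) d(2)[unfolded dist_commute[of C]] by (simp only: assms(7))
  finally have "triangle_area A B C = sqrt (s * (s - a) * (s - b) * (s - c))" .
  then show "triangle_area A B C = \<Delta>"
    using assms(6,8) by (metis real_sqrt_unique)
qed

theorem theorem1p2:
  fixes n :: int and S T :: "int \<Rightarrow> real" and a b c k l \<Delta> s :: real
  assumes "S = somos_S" and "T = somos_T" and "n \<ge> 1"
    and "a = \<bar>S (n+1) * S (n+2) ^ 3 * S (n+3) * T (n+2) + S n ^ 2 * S (n+1) * T (n+3) * T (n+4) ^ 2\<bar>"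
    and "b = \<bar>S n ^ 2 * S (n+1) * T (n+3) * T (n+4) ^ 2 - T (n+1) * T (n+2) ^ 3 * T (n+3) * S (n+2)\<bar>"
    and "c = \<bar>T (n+1) * T (n+2) ^ 3 * T (n+3) * S (n+2) - S (n+1) * S (n+2) ^ 3 * S (n+3) * T (n+2)\<bar>"
    and "k = 1/2 * \<bar>S (n+4) * T (n+4) * (T n * T (n+1) ^ 2 * T (n+2) - S n * S (n+1) ^ 2 * S (n+2))\<bar>"
    and "l = 1/2 * \<bar>S n * T n * (T (n+2) * T (n+3) ^ 2 * T (n+4) - S (n+2) * S (n+3) ^ 2 * S (n+4))\<bar>"
    and "\<Delta> = \<bar>S n * S (n+1) * S (n+2) ^ 2 * S (n+3) * S (n+4) * T n * T (n+1) * T (n+2) ^ 2 * T (n+3) * T (n+4)\<bar>"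
    and "s = (a + b + c) / 2"
  shows "(\<exists>a' b' c' :: nat. a = real a' \<and> b = real b' \<and> c = real c' \<and>
            0 < a' \<and> 0 < b' \<and> 0 < c' \<and> gcd a' (gcd b' c') = 1)
       \<and> (\<exists>A B C. triangle_with_sides A B C a b c)
       \<and> (\<forall>A B C. triangle_with_sides A B C a b c \<longrightarrow>
            dist A (midpoint B C) = k \<and> dist B (midpoint C A) = l \<and>
            triangle_area A B C = \<Delta> \<and> heron_triangle A B C)
       \<and> k ^ 2 = 1/4 * (2 * b ^ 2 + 2 * c ^ 2 - a ^ 2) \<and> k \<in> \<rat>
       \<and> l ^ 2 = 1/4 * (2 * c ^ 2 + 2 * a ^ 2 - b ^ 2) \<and> l \<in> \<rat>
       \<and> \<Delta> ^ 2 = s * (s - a) * (s - b) * (s - c)"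
proof -
  obtain m where m: "n = int m" "0 < m"
    using \<open>n \<ge> 1\<close> zero_less_imp_eq_int[of n] by auto
  have shift: "n + 1 = int (m + 1)" "n + 2 = int (m + 2)" "n + 3 = int (m + 3)" "n + 4 = int (m + 4)"
    using m by simp_all
  define x where "x = sseq (m + 1) * sseq (m + 2) ^ 3 * sseq (m + 3) * tseq (m + 2)"
  define y where "y = sseq m ^ 2 * sseq (m + 1) * tseq (m + 3) * tseq (m + 4) ^ 2"
  define z where "z = tseq (m + 1) * tseq (m + 2) ^ 3 * tseq (m + 3) * sseq (m + 2)"
  define w where "w = sseq (m + 3) * sseq (m + 4) ^ 2 * tseq m ^ 2 * tseq (m + 1)"
  define K where "K = sseq (m + 4) * tseq (m + 4) * (tseq m * tseq (m + 1) ^ 2 * tseq (m + 2) - sseq m * sseq (m + 1) ^ 2 * sseq (m + 2))"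
  define L where "L = sseq m * tseq m * (tseq (m + 2) * tseq (m + 3) ^ 2 * tseq (m + 4) - sseq (m + 2) * sseq (m + 3) ^ 2 * sseq (m + 4))"
  define D where "D = sseq m * sseq (m + 1) * sseq (m + 2) ^ 2 * sseq (m + 3) * sseq (m + 4) * tseq m * tseq (m + 1) * tseq (m + 2) ^ 2 * tseq (m + 3) * tseq (m + 4)"
  have abs: "a = \<bar>x + y\<bar>" "b = \<bar>y - z\<bar>" "c = \<bar>z - x\<bar>" "k = 1/2 * \<bar>K\<bar>" "l = 1/2 * \<bar>L\<bar>" "\<Delta> = \<bar>D\<bar>"
    using assms(4-9) unfolding shift unfolding m(1) assms(1,2) somos_S_eq somos_T_eq
    by (simp_all only: x_def y_def z_def K_def L_def D_def)
  note ids = seq_heron_median_identities[of m, folded x_def y_def z_def w_def K_def L_def]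

  have k2: "k\<^sup>2 = 1/4 * (2 * b\<^sup>2 + 2 * c\<^sup>2 - a\<^sup>2)" and l2: "l\<^sup>2 = 1/4 * (2 * c\<^sup>2 + 2 * a\<^sup>2 - b\<^sup>2)"
    unfolding abs using ids(2,3) by (simp_all add: power_mult_distrib power_divide)
  have heron16: "(a + b + c) * (- a + b + c) * (a - b + c) * (a + b - c) = 16 * \<Delta>\<^sup>2"
  proof -
    \<comment> \<open>The expansion contains only even powers of the sides, so the absolute values
      drop out.\<close>
    have "(a + b + c) * (- a + b + c) * (a - b + c) * (a + b - c)
        = 2 * (a\<^sup>2 * b\<^sup>2 + b\<^sup>2 * c\<^sup>2 + c\<^sup>2 * a\<^sup>2) - (a\<^sup>2)\<^sup>2 - (b\<^sup>2)\<^sup>2 - (c\<^sup>2)\<^sup>2"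
      by algebra
    also have "\<dots> = 2 * ((x + y)\<^sup>2 * (y - z)\<^sup>2 + (y - z)\<^sup>2 * (z - x)\<^sup>2 + (z - x)\<^sup>2 * (x + y)\<^sup>2)
        - ((x + y)\<^sup>2)\<^sup>2 - ((y - z)\<^sup>2)\<^sup>2 - ((z - x)\<^sup>2)\<^sup>2"
      unfolding abs power2_abs ..
    \<comment> \<open>For the signed sides x + y, y - z, z - x the four factors of Heron's product
      are 2 y, - 2 x, 2 z and - 2 w.\<close>
    also have "\<dots> = 16 * (x * y * z * w)"
      unfolding ids(1) by algebra
    also have "x * y * z * w = D\<^sup>2"
      unfolding x_def y_def z_def w_def D_def by algebra
    finally show ?thesis by (simp add: abs)
  qed
  have \<Delta>2: "\<Delta>\<^sup>2 = s * (s - a) * (s - b) * (s - c)"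
  proof -
    have e: "2 * s = a + b + c" "2 * (s - a) = - a + b + c" "2 * (s - b) = a - b + c" "2 * (s - c) = a + b - c"
      by (simp_all add: assms(10))
    have "16 * (s * (s - a) * (s - b) * (s - c)) = (2 * s) * (2 * (s - a)) * (2 * (s - b)) * (2 * (s - c))"
      by algebra
    also have "\<dots> = 16 * \<Delta>\<^sup>2"
      unfolding e by (rule heron16)
    finally show ?thesis by simp
  qed
  have nonneg: "0 \<le> a" "0 \<le> b" "0 \<le> c" "0 \<le> k" "0 \<le> l" "0 \<le> \<Delta>"
    by (simp_all add: abs)
  \<comment> \<open>Positivity of \<open>m\<close> makes \<open>tseq m\<close> nonzero. The nonzero
    area then gives the strict triangle inequalities, and these the positivity of the sides.\<close>
  have "D \<noteq> 0" using m(2) by (simp add: D_def tseq_nonzero)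
  then have pos: "0 < (a + b + c) * (- a + b + c) * (a - b + c) * (a + b - c)"
    unfolding heron16 by (simp add: abs)
  note strict = heron_strict_triangle[OF nonneg(1-3) pos]

  interpret integral_prefix "\<lambda>k. \<lfloor>sseq k\<rfloor>" "\<lambda>k. \<lfloor>tseq k\<rfloor>" "m + 4"
    by (rule integral_prefix_floor)
  have of_int: "real_of_int (term_x m) = x" "real_of_int (term_y m) = y" "real_of_int (term_z m) = z"
    "real_of_int (term_w m) = w"
    unfolding term_x_def term_y_def term_z_def term_w_def x_def y_def z_def w_def
    by (simp_all flip: sseq_of_int tseq_of_int)
  have sum: "term_z m = term_x m + term_y m + term_w m"
    using ids(1) unfolding of_int[symmetric] by (simp only: of_int_eq_iff flip: of_int_add)
  define a' b' c' where "a' = nat \<bar>term_x m + term_y m\<bar>" and "b' = nat \<bar>term_y m - term_z m\<bar>"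
    and "c' = nat \<bar>term_z m - term_x m\<bar>"
  have nats: "a = real a'" "b = real b'" "c = real c'"
    by (simp_all add: abs a'_def b'_def c'_def flip: of_int)
  have gcd: "gcd a' (gcd b' c') = 1"
  proof (rule ccontr)
    assume "gcd a' (gcd b' c') \<noteq> 1"
    then obtain p where p: "prime p" "p dvd gcd a' (gcd b' c')"
      using prime_factor_nat by blast
    have "int p dvd int a'" "int p dvd int b'" "int p dvd int c'"
      using p(2) by auto
    then have "int p dvd term_x m + term_y m" "int p dvd term_y m - term_z m" "int p dvd term_z m - term_x m"
      unfolding a'_def b'_def c'_def by simp_all
    then show False
      using no_common_prime_sides[of "int p" m] p(1) sum by simp
  qed
  have sides: "\<exists>a' b' c' :: nat. a = real a' \<and> b = real b' \<and> c = real c' \<and>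
      0 < a' \<and> 0 < b' \<and> 0 < c' \<and> gcd a' (gcd b' c') = 1"
    using nats gcd strict by (intro exI[of _ a'] exI[of _ b'] exI[of _ c']) auto

  have Ints: "K \<in> \<int>" "L \<in> \<int>" "D \<in> \<int>"
    unfolding K_def L_def D_def using seq_Ints by (auto intro!: Ints_mult Ints_diff Ints_power)
  then have rats: "k \<in> \<rat>" "l \<in> \<rat>"
    unfolding abs using Ints_subset_Rats by (auto intro!: Rats_mult)
  have "dist A (midpoint B C) = k \<and> dist B (midpoint C A) = l \<and> triangle_area A B C = \<Delta> \<and> heron_triangle A B C"
    if tri: "triangle_with_sides A B C a b c" for A B C
  proof -
    note measures = triangle_with_sides_measures[OF tri nonneg(4) k2 nonneg(5) l2 nonneg(6) assms(10) \<Delta>2]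
    have "heron_triangle A B C"
      using tri measures(3) Ints(3) nats unfolding heron_triangle_def triangle_with_sides_def abs by auto
    then show ?thesis using measures by blast
  qed
  then show ?thesis
    using sides triangle_with_sides_exists[OF nonneg(1-3) pos] k2 l2 rats \<Delta>2 by blast
qed

end
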